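(* Let $G$ be a group admitting a topologically minimal non-elementary convergence action on a compactum $M$. Given $\xi\in M$, the following are equivalent: (1) $\xi$ is either conical or bounded parabolic. (2) There exists a compact subset $K\subset\Theta^2(M)$ such that $\{\xi,\eta\}\in GK$ for every $\eta\in M\setminus\{\xi\}$. (3) There exists a compact subset $K\subset\Theta^2(M)$ such that $\Theta^2(G\xi)\subset GK$.
   Context: A compactum is a compact Hausdorff space (not assumed metrizable). An action of a group $G$ by homeomorphisms on a compactum $M$ is a convergence action if for every sequence $\{g_n\}$ of distinct elements of $G$ there are a subsequence $\{g_{n_i}\}$ and points $a,b\in M$ such that $g_{n_i}x\to b$ locally uniformly on $M\setminus\{a\}$. A sequence $\{g_n\}$ in $G$ with $g_nx\to b$ locally uniformly on $M\setminus\{a\}$ is called a convergence sequence with attracting point $b$ and repelling point $a$. The limit set $\Lambda H$ of a subgroup $H\le G$ is the set of attracting points of convergence sequences in $H$. The action is non-elementary if $\#\Lambda G>2$, and topologically minimal if $M=\Lambda G$. A point $\xi\in M$ is conical if there is a convergence sequence $\{g_n\}$ with attracting point $b\in M$ and repelling point $\xi$ such that $\{g_n\xi\}$ converges to a point different from $b$. A point $\xi\in M$ is parabolic if its stabilizer $G_\xi$ is infinite and $\Lambda G_\xi=\{\xi\}$; a parabolic point $\xi$ is bounded parabolic if $G_\xi$ acts cocompactly on $M\setminus\{\xi\}$. For a set $X$, $\Theta^2(X)$ is the collection of subsets of $X$ of cardinality $2$. The set $\Theta^2(M)$ is topologized as a subspace of $S^2(M)=M^2/\sim$, where $(x,y)\sim(y,x)$,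 with the quotient topology. $G$ acts on $\Theta^2(M)$ by $g\{x,y\}=\{gx,gy\}$, $GK=\bigcup_{g\in G}gK$, and $G\xi$ is the $G$-orbit of $\xi$. *)

theory Defs
  imports
    "HOL-Analysis.Analysis"
    "HOL-Algebra.Group_Action"
    "HOL-Library.Ramsey"
begin

text \<open>
  A compactum carries a unique compatible uniformity, whose entourages cut out exactly the
  neighbourhoods of a given point \<open>b\<close>. Uniform convergence of \<open>f n\<close> on \<open>V\<close> to the constant map
  \<open>b\<close> therefore means that every neighbourhood of \<open>b\<close> eventually contains \<open>f n ` V\<close>.
\<close>

definition uniformly_to :: "'a topology \<Rightarrow> (nat \<Rightarrow> 'a \<Rightarrow> 'a) \<Rightarrow> 'a \<Rightarrow> 'a set \<Rightarrow> bool" where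
  "uniformly_to M f b V \<longleftrightarrow>
     (\<forall>U. openin M U \<and> b \<in> U \<longrightarrow> (\<forall>\<^sub>F n in sequentially. f n ` V \<subseteq> U))"

definition locally_uniformly_to :: "'a topology \<Rightarrow> (nat \<Rightarrow> 'a \<Rightarrow> 'a) \<Rightarrow> 'a \<Rightarrow> 'a set \<Rightarrow> bool" where
  "locally_uniformly_to M f b A \<longleftrightarrow>
     (\<forall>x\<in>A. \<exists>V. openin (subtopology M A) V \<and> x \<in> V \<and> uniformly_to M f b V)"

text \<open>Arguments: attracting point \<open>b\<close>, then repelling point \<open>a\<close>; they may coincide.\<close>

definition convergence_sequence ::
    "'a topology \<Rightarrow> ('g \<Rightarrow> 'a \<Rightarrow> 'a) \<Rightarrow> (nat \<Rightarrow> 'g) \<Rightarrow> 'a \<Rightarrow> 'a \<Rightarrow> bool" where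
  "convergence_sequence M \<phi> g b a \<longleftrightarrow>
     a \<in> topspace M \<and> b \<in> topspace M \<and>
     locally_uniformly_to M (\<lambda>n. \<phi> (g n)) b (topspace M - {a})"

locale convergence_action = group_action G "topspace M" \<phi>
  for G (structure) and M :: "'a topology" and \<phi> +
  assumes compact: "compact_space M"
    and Hausdorff: "Hausdorff_space M"
    and homeomorphic: "g \<in> carrier G \<Longrightarrow> homeomorphic_map M M (\<phi> g)"
    and convergence:
      "\<lbrakk>range s \<subseteq> carrier G; inj s\<rbrakk> \<Longrightarrow>
         \<exists>r a b. strict_mono (r :: nat \<Rightarrow> nat) \<and> convergence_sequence M \<phi> (s \<circ> r) b a"

definition limit_set :: "'a topology \<Rightarrow> ('g \<Rightarrow> 'a \<Rightarrow> 'a) \<Rightarrow> 'g set \<Rightarrow> 'a set" where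
  "limit_set M \<phi> H = {b. \<exists>g a. range g \<subseteq> H \<and> convergence_sequence M \<phi> g b a}"

text \<open>The first disjunct is needed because \<open>card\<close> of an infinite set is \<open>0\<close>.\<close>

definition non_elementary where
  "non_elementary G M \<phi> \<longleftrightarrow>
     infinite (limit_set M \<phi> (carrier G)) \<or> card (limit_set M \<phi> (carrier G)) > 2"

definition topologically_minimal where
  "topologically_minimal G M \<phi> \<longleftrightarrow> topspace M = limit_set M \<phi> (carrier G)"

definition translates :: "'g set \<Rightarrow> ('g \<Rightarrow> 'b \<Rightarrow> 'b) \<Rightarrow> 'b set \<Rightarrow> 'b set" where
  "translates H \<psi> K = (\<Union>h\<in>H. \<psi> h ` K)"

definition conical where
  "conical G M \<phi> \<xi> \<longleftrightarrow> \<xi> \<in> topspace M \<and>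
     (\<exists>g b c. range g \<subseteq> carrier G \<and> convergence_sequence M \<phi> g b \<xi> \<and>
        limitin M (\<lambda>n. \<phi> (g n) \<xi>) c sequentially \<and> c \<noteq> b)"

definition parabolic where
  "parabolic G M \<phi> \<xi> \<longleftrightarrow> \<xi> \<in> topspace M \<and>
     infinite (stabilizer G \<phi> \<xi>) \<and> limit_set M \<phi> (stabilizer G \<phi> \<xi>) = {\<xi>}"

definition cocompact_on :: "'a topology \<Rightarrow> ('g \<Rightarrow> 'a \<Rightarrow> 'a) \<Rightarrow> 'g set \<Rightarrow> 'a set \<Rightarrow> bool" where
  "cocompact_on M \<phi> H A \<longleftrightarrow> (\<exists>C. C \<subseteq> A \<and> compactin M C \<and> translates H \<phi> C = A)"

definition bounded_parabolic where
  "bounded_parabolic G M \<phi> \<xi> \<longleftrightarrow> parabolic G M \<phi> \<xi> \<and>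
     cocompact_on M \<phi> (stabilizer G \<phi> \<xi>) (topspace M - {\<xi>})"

definition quotient_topology :: "'a topology \<Rightarrow> ('a \<Rightarrow> 'b) \<Rightarrow> 'b topology" where
  "quotient_topology X q =
     topology (\<lambda>U. U \<subseteq> q ` topspace X \<and> openin X {x \<in> topspace X. q x \<in> U})"

lemma openin_quotient_topology:
  "openin (quotient_topology X q) U \<longleftrightarrow>
     U \<subseteq> q ` topspace X \<and> openin X {x \<in> topspace X. q x \<in> U}"
proof -
  have "istopology (\<lambda>U. U \<subseteq> q ` topspace X \<and> openin X {x \<in> topspace X. q x \<in> U})"
    unfolding istopology_def
  proof (intro conjI allI impI)
    fix S T
    assume "S \<subseteq> q ` topspace X \<and> openin X {x \<in> topspace X. q x \<in> S}"
      and "T \<subseteq> q ` topspace X \<and> openin X {x \<in> topspace X. q x \<in> T}"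
    moreover have "{x \<in> topspace X. q x \<in> S \<inter> T} =
        {x \<in> topspace X. q x \<in> S} \<inter> {x \<in> topspace X. q x \<in> T}" by auto
    ultimately show "S \<inter> T \<subseteq> q ` topspace X" "openin X {x \<in> topspace X. q x \<in> S \<inter> T}"
      by auto
  next
    fix \<K>
    assume *: "\<forall>K\<in>\<K>. K \<subseteq> q ` topspace X \<and> openin X {x \<in> topspace X. q x \<in> K}"
    have "{x \<in> topspace X. q x \<in> \<Union>\<K>} = (\<Union>K\<in>\<K>. {x \<in> topspace X. q x \<in> K})" by auto
    with * show "\<Union>\<K> \<subseteq> q ` topspace X" "openin X {x \<in> topspace X. q x \<in> \<Union>\<K>}"
      by auto
  qed
  then show ?thesis
    by (simp add: quotient_topology_def)
qed

lemma topspace_quotient_topology: "topspace (quotient_topology X q) = q ` topspace X"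
proof
  show "topspace (quotient_topology X q) \<subseteq> q ` topspace X"
    using openin_quotient_topology[of X q] openin_topspace by blast
  have "{x \<in> topspace X. q x \<in> q ` topspace X} = topspace X" by auto
  then have "openin (quotient_topology X q) (q ` topspace X)"
    by (simp add: openin_quotient_topology)
  then show "q ` topspace X \<subseteq> topspace (quotient_topology X q)"
    by (rule openin_subset)
qed

lemma quotient_map_quotient_topology: "quotient_map X (quotient_topology X q) q"
  by (auto simp: quotient_map_def topspace_quotient_topology openin_quotient_topology)

text \<open>
  The class of \<open>(x, y)\<close> modulo \<open>(x, y) \<sim> (y, x)\<close> is represented by the set \<open>{x, y}\<close>, so that
  the diagonal becomes the singletons and \<open>\<Theta>\<^sup>2\<close> is literally the part consisting of the
  two-element sets.
\<close>

definition symmetric_square :: "'a topology \<Rightarrow> 'a set topology" where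
  "symmetric_square M = quotient_topology (prod_topology M M) (\<lambda>(x, y). {x, y})"

abbreviation Theta2 :: "'a set \<Rightarrow> 'a set set" where
  "Theta2 X \<equiv> nsets X 2"

definition Theta2_topology :: "'a topology \<Rightarrow> 'a set topology" where
  "Theta2_topology M = subtopology (symmetric_square M) (Theta2 (topspace M))"

abbreviation pair_action :: "('g \<Rightarrow> 'a \<Rightarrow> 'a) \<Rightarrow> 'g \<Rightarrow> 'a set \<Rightarrow> 'a set" where
  "pair_action \<phi> g P \<equiv> \<phi> g ` P"

lemma topspace_Theta2_topology: "topspace (Theta2_topology M) = Theta2 (topspace M)"
  by (auto simp: Theta2_topology_def symmetric_square_def topspace_quotient_topology nsets_2_eq)

end

theory Submission
  imports Defs
begin

text \<open>
  A compact subset of \<open>\<Theta>\<^sup>2(M)\<close> is one that avoids an entourage \<open>U\<close> of the compactum, so the third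
  condition says that any two points of the orbit of \<open>\<xi>\<close> can be moved \<open>U\<close>-apart. Suppose that this
  holds and that \<open>\<xi>\<close> is not conical. Then \<open>g n \<xi>\<close> tends to the attracting point of every convergence
  sequence of distinct elements, and so only finitely many group elements separate \<open>\<xi>\<close> from a given
  \<open>\<eta>\<close> in its orbit. Choosing the one closest to \<open>\<xi>\<close>, in the sense of a maximal set of points far from
  the image of \<open>\<xi>\<close>, only finitely many images of \<open>\<xi>\<close> occur. The stabilizer of \<open>\<xi>\<close> therefore moves
  every \<open>\<eta>\<close> in the orbit into a fixed compact subset of \<open>M - {\<xi>}\<close>; by density of the orbit and proper
  discontinuity of the stabilizer the same holds for every \<open>\<eta> \<noteq> \<xi>\<close>.
\<close>

section \<open>Entourages of a compactum\<close>

text \<open>In a compactum the open neighbourhoods of the diagonal form a base of the unique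
  compatible uniformity, so they can stand for its entourages. Symmetry is not built in;
  \<open>entourage_half\<close> supplies it.\<close>

definition entourage :: "'a topology \<Rightarrow> ('a \<times> 'a) set \<Rightarrow> bool" where
  "entourage M U \<longleftrightarrow> openin (prod_topology M M) U \<and> Id_on (topspace M) \<subseteq> U"

lemma entourage_nhd:
  assumes "entourage M U" "b \<in> topspace M"
  obtains N where "openin M N" "b \<in> N" "N \<times> N \<subseteq> U"
proof -
  have "(b, b) \<in> U"
    using assms by (auto simp: entourage_def)
  then obtain A B where "openin M A" "openin M B" "b \<in> A" "b \<in> B" "A \<times> B \<subseteq> U"
    using assms unfolding entourage_def openin_prod_topology_alt by blast
  then show thesis
    by (intro that[of "A \<inter> B"]) auto
qed

lemma entourage_Int: "entourage M U \<Longrightarrow> entourage M V \<Longrightarrow> entourage M (U \<inter> V)"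
  by (auto simp: entourage_def)

text \<open>The factor \<open>topspace M \<times> topspace M\<close> gives the empty family the
  right value; the bare intersection would be the whole type.\<close>

lemma entourage_Inter:
  assumes "finite I" "\<And>i. i \<in> I \<Longrightarrow> entourage M (U i)"
  shows "entourage M (topspace M \<times> topspace M \<inter> (\<Inter>i\<in>I. U i))"
  using assms
proof (induction I)
  case empty
  then show ?case
    using openin_topspace[of "prod_topology M M"] by (auto simp: entourage_def)
next
  case (insert i I)
  then have "entourage M (U i)" "entourage M (topspace M \<times> topspace M \<inter> (\<Inter>i\<in>I. U i))"
    by auto
  then have "entourage M (U i \<inter> (topspace M \<times> topspace M \<inter> (\<Inter>i\<in>I. U i)))"
    by (rule entourage_Int)
  then show ?case
    by (simp add: Int_ac)
qed

text \<open>The product of two disjoint closed sets is closed and misses the diagonal. All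
  entourages constructed below are finite intersections of such complements.\<close>

lemma entourage_closed_complement:
  assumes "closedin M A" "closedin M B" "A \<inter> B = {}"
  shows "entourage M (topspace M \<times> topspace M - A \<times> B)"
  using assms closedin_subset[of M] openin_diff[of "prod_topology M M" "topspace M \<times> topspace M" "A \<times> B"]
  by (auto simp: entourage_def closedin_prod_Times_iff openin_prod_Times_iff)

text \<open>Disjoint neighbourhoods are shrunk by regularity until closed neighbourhoods fit inside
  them.\<close>

lemma Hausdorff_separate_closures:
  assumes "regular_space M" "Hausdorff_space M" "x \<in> topspace M" "y \<in> topspace M" "x \<noteq> y"
  obtains A B where "openin M A" "openin M B" "x \<in> A" "y \<in> B"
    "(M closure_of A) \<inter> (M closure_of B) = {}"
proof -
  obtain A0 B0 where 0: "openin M A0" "openin M B0" "x \<in> A0" "y \<in> B0" "disjnt A0 B0"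
    using assms unfolding Hausdorff_space_def by meson
  have nhd: "\<And>z W. openin M W \<Longrightarrow> z \<in> W \<Longrightarrow> \<exists>U V. openin M U \<and> closedin M V \<and> z \<in> U \<and> U \<subseteq> V \<and> V \<subseteq> W"
    using assms(1) unfolding neighbourhood_base_of_closedin[symmetric] neighbourhood_base_of by blast
  obtain A A' B B' where "openin M A" "closedin M A'" "x \<in> A" "A \<subseteq> A'" "A' \<subseteq> A0"
    "openin M B" "closedin M B'" "y \<in> B" "B \<subseteq> B'" "B' \<subseteq> B0"
    using nhd[OF 0(1,3)] nhd[OF 0(2,4)] by blast
  then show thesis
    using that[of A B] 0(5) closure_of_minimal[of A A' M] closure_of_minimal[of B B' M]
    unfolding disjnt_def by blast
qed

text \<open>The triangle inequality of the uniformity. Each pair outside \<open>U\<close> has a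
  neighbourhood that \<open>V p O V p\<close> misses for a suitable symmetric entourage
  \<open>V p\<close>; the complement of \<open>U\<close> is compact, so finitely many
  \<open>V p\<close> suffice.\<close>

lemma entourage_half:
  assumes "compact_space M" "Hausdorff_space M" "entourage M U"
  obtains V where "entourage M V" "sym V" "V O V \<subseteq> U"
proof -
  have reg: "regular_space M"
    using assms compact_Hausdorff_imp_regular_space by blast
  let ?C = "topspace M \<times> topspace M - U"
  have "closedin (prod_topology M M) ?C"
    using assms(3) closedin_diff[OF closedin_topspace, of "prod_topology M M" U]
    by (simp add: entourage_def)
  then have C: "compactin (prod_topology M M) ?C"
    by (simp add: assms(1) closedin_compact_space compact_space_prod_topology)
  have "\<exists>A B V. openin M A \<and> openin M B \<and> fst p \<in> A \<and> snd p \<in> B \<and> entourage M V \<and> sym V \<and>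
      (V O V) \<inter> A \<times> B = {}" if "p \<in> ?C" for p
  proof -
    have "fst p \<in> topspace M" "snd p \<in> topspace M" "fst p \<noteq> snd p"
      using that assms(3) by (auto simp: entourage_def)
    then obtain A1 B1 where 1: "openin M A1" "openin M B1" "fst p \<in> A1" "snd p \<in> B1"
      "(M closure_of A1) \<inter> (M closure_of B1) = {}"
      using Hausdorff_separate_closures[OF reg assms(2)] by metis
    have nhd: "\<And>z W. openin M W \<Longrightarrow> z \<in> W \<Longrightarrow> \<exists>U V. openin M U \<and> closedin M V \<and> z \<in> U \<and> U \<subseteq> V \<and> V \<subseteq> W"
      using reg unfolding neighbourhood_base_of_closedin[symmetric] neighbourhood_base_of by blast
    obtain A A' B B' where 2: "openin M A" "closedin M A'" "fst p \<in> A" "A \<subseteq> A'" "A' \<subseteq> A1"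
      "openin M B" "closedin M B'" "snd p \<in> B" "B \<subseteq> B'" "B' \<subseteq> B1"
      using nhd[OF 1(1,3)] nhd[OF 1(2,4)] by blast
    let ?X = "topspace M \<times> topspace M"
    \<comment> \<open>\<open>V\<close> relates points of \<open>A'\<close> only to points of
      \<open>A1\<close> and points of \<open>B'\<close> only to points of \<open>B1\<close>, so a
      point between \<open>A\<close> and \<open>B\<close> would lie in the empty set
      \<open>A1 \<inter> B1\<close>. Each condition is imposed in both orders to make
      \<open>V\<close> symmetric.\<close>
    define V where "V = (?X - A' \<times> (topspace M - A1)) \<inter> (?X - (topspace M - A1) \<times> A') \<inter>
      ((?X - B' \<times> (topspace M - B1)) \<inter> (?X - (topspace M - B1) \<times> B'))"
    have "closedin M (topspace M - A1)" "closedin M (topspace M - B1)"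
      using 1 by auto
    then have "entourage M V"
      using 2 unfolding V_def
      by (intro entourage_Int entourage_closed_complement) auto
    have V_iff: "(s, t) \<in> V \<longleftrightarrow> s \<in> topspace M \<and> t \<in> topspace M \<and>
        (s \<in> A' \<longrightarrow> t \<in> A1) \<and> (t \<in> A' \<longrightarrow> s \<in> A1) \<and>
        (s \<in> B' \<longrightarrow> t \<in> B1) \<and> (t \<in> B' \<longrightarrow> s \<in> B1)" for s t
      unfolding V_def Int_iff Diff_iff mem_Sigma_iff by argo
    have "sym V"
      by (simp add: sym_def V_iff)
    have "A1 \<inter> B1 = {}"
      using 1 closure_of_subset[of A1 M] closure_of_subset[of B1 M] openin_subset[of M] by blast
    have "(x, y) \<notin> A \<times> B" if "(x, z) \<in> V" "(z, y) \<in> V" for x z y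
    proof
      assume "(x, y) \<in> A \<times> B"
      then have "z \<in> A1" "z \<in> B1"
        using that 2(4,9) by (auto simp: V_iff)
      then show False
        using \<open>A1 \<inter> B1 = {}\<close> by auto
    qed
    then have "(V O V) \<inter> A \<times> B = {}"
      by blast
    then show ?thesis
      using \<open>entourage M V\<close> \<open>sym V\<close> 2(1,3,6,8) by (intro exI conjI)
  qed
  then obtain A B V where ABV: "\<And>p. p \<in> ?C \<Longrightarrow> openin M (A p) \<and> openin M (B p) \<and> fst p \<in> A p \<and>
      snd p \<in> B p \<and> entourage M (V p) \<and> sym (V p) \<and> (V p O V p) \<inter> A p \<times> B p = {}"
    by metis
  have "\<exists>\<F>. finite \<F> \<and> \<F> \<subseteq> (\<lambda>p. A p \<times> B p) ` ?C \<and> ?C \<subseteq> \<Union>\<F>"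
  proof (rule compactinD[OF C])
    show "openin (prod_topology M M) S" if "S \<in> (\<lambda>p. A p \<times> B p) ` ?C" for S
      using that ABV by (auto simp: openin_prod_Times_iff)
    show "?C \<subseteq> \<Union> ((\<lambda>p. A p \<times> B p) ` ?C)"
    proof
      fix p assume p: "p \<in> ?C"
      then have "p \<in> A p \<times> B p"
        using ABV[OF p] by (auto simp: mem_Times_iff)
      then show "p \<in> \<Union> ((\<lambda>p. A p \<times> B p) ` ?C)"
        using p by blast
    qed
  qed
  then obtain I where I: "finite I" "I \<subseteq> ?C" "?C \<subseteq> (\<Union>p\<in>I. A p \<times> B p)"
    by (metis (no_types, lifting) finite_subset_image)
  let ?V = "topspace M \<times> topspace M \<inter> (\<Inter>p\<in>I. V p)"
  show thesis
  proof
    show "entourage M ?V"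
      using I ABV by (intro entourage_Inter) auto
    show "sym ?V"
    proof (rule symI)
      fix x y assume "(x, y) \<in> ?V"
      then show "(y, x) \<in> ?V"
        using I(2) ABV symD[of "V _" x y] by auto
    qed
    show "?V O ?V \<subseteq> U"
    proof (rule ccontr)
      assume "\<not> ?V O ?V \<subseteq> U"
      then obtain x z y where xyz: "(x, z) \<in> ?V" "(z, y) \<in> ?V" "(x, y) \<in> ?C"
        by blast
      from subsetD[OF I(3) xyz(3)] obtain p where "p \<in> I" "(x, y) \<in> A p \<times> B p"
        by (rule UN_E)
      then have "(x, y) \<notin> V p O V p"
        using ABV[of p] I(2) by auto
      moreover have "(x, z) \<in> V p" "(z, y) \<in> V p"
        using xyz \<open>p \<in> I\<close> by auto
      ultimately show False
        by auto
    qed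
  qed
qed

lemma closedin_entourage_section:
  assumes "entourage M U" "p \<in> topspace M"
  shows "closedin M {q \<in> topspace M. (p, q) \<notin> U}"
proof -
  have "continuous_map M (prod_topology M M) (\<lambda>q. (p, q))"
    using assms by (simp add: continuous_map_pairwise comp_def)
  then have "openin M {q \<in> topspace M. (p, q) \<in> U}"
    using assms openin_continuous_map_preimage unfolding entourage_def by blast
  moreover have "{q \<in> topspace M. (p, q) \<notin> U} = topspace M - {q \<in> topspace M. (p, q) \<in> U}"
    by auto
  ultimately show ?thesis
    by auto
qed

text \<open>Every pair in \<open>K\<close> has a neighbourhood given by two open sets with disjoint
  closures. Finitely many of these cover \<open>K\<close>, and removing the products of the closures
  from the square leaves the entourage.\<close>

lemma compactin_Theta2_avoids_entourage:
  assumes "compact_space M" "Hausdorff_space M" "compactin (Theta2_topology M) K"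
  obtains U where "entourage M U" "\<And>x y. {x, y} \<in> K \<Longrightarrow> (x, y) \<notin> U"
proof -
  have reg: "regular_space M"
    using assms compact_Hausdorff_imp_regular_space by blast
  let ?q = "\<lambda>(x, y). {x, y}"
  have K: "compactin (symmetric_square M) K" "K \<subseteq> Theta2 (topspace M)"
    using assms(3) by (auto simp: Theta2_topology_def compactin_subtopology)
  have "\<exists>A B. openin M A \<and> openin M B \<and> P \<in> ?q ` (A \<times> B) \<and>
      (M closure_of A) \<inter> (M closure_of B) = {}" if "P \<in> K" for P
  proof -
    obtain x y where xy: "P = {x, y}" "x \<noteq> y" "x \<in> topspace M" "y \<in> topspace M"
      using \<open>P \<in> K\<close> K(2) unfolding nsets_2_eq by blast
    then obtain A B where "openin M A" "openin M B" "x \<in> A" "y \<in> B"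
      "(M closure_of A) \<inter> (M closure_of B) = {}"
      using Hausdorff_separate_closures[OF reg assms(2)] by metis
    then show ?thesis
      using xy by blast
  qed
  then obtain A B where AB: "\<And>P. P \<in> K \<Longrightarrow> openin M (A P) \<and> openin M (B P) \<and>
      P \<in> ?q ` (A P \<times> B P) \<and> (M closure_of A P) \<inter> (M closure_of B P) = {}"
    by metis
  have op: "openin (symmetric_square M) (?q ` (A P \<times> B P))" if "P \<in> K" for P
  proof -
    have sub: "A P \<subseteq> topspace M" "B P \<subseteq> topspace M"
      using AB that openin_subset by blast+
    \<comment> \<open>Openness in the quotient is openness of the preimage, which contains the
      product in both orders because pairs are unordered.\<close>
    have "{z \<in> topspace (prod_topology M M). ?q z \<in> ?q ` (A P \<times> B P)} = A P \<times> B P \<union> B P \<times> A P"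
      using sub by (auto simp: doubleton_eq_iff)
    moreover have "openin (prod_topology M M) (A P \<times> B P \<union> B P \<times> A P)"
      using AB[OF that] by (intro openin_Un) (auto simp: openin_prod_Times_iff)
    moreover have "?q ` (A P \<times> B P) \<subseteq> ?q ` topspace (prod_topology M M)"
      using sub by auto
    ultimately show ?thesis
      unfolding symmetric_square_def openin_quotient_topology by metis
  qed
  have "\<exists>\<F>. finite \<F> \<and> \<F> \<subseteq> (\<lambda>P. ?q ` (A P \<times> B P)) ` K \<and> K \<subseteq> \<Union>\<F>"
  proof (rule compactinD[OF K(1)])
    show "openin (symmetric_square M) S" if "S \<in> (\<lambda>P. ?q ` (A P \<times> B P)) ` K" for S
      using that op by (elim imageE) simp
    show "K \<subseteq> \<Union> ((\<lambda>P. ?q ` (A P \<times> B P)) ` K)"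
    proof
      fix P assume "P \<in> K"
      from AB[OF this] have "P \<in> ?q ` (A P \<times> B P)"
        by (elim conjE)
      with \<open>P \<in> K\<close> show "P \<in> \<Union> ((\<lambda>P. ?q ` (A P \<times> B P)) ` K)"
        by (rule UN_I)
    qed
  qed
  then obtain \<F> where \<F>: "finite \<F>" "\<F> \<subseteq> (\<lambda>P. ?q ` (A P \<times> B P)) ` K" "K \<subseteq> \<Union>\<F>"
    by (elim exE conjE)
  from finite_subset_image[OF \<F>(1,2)] obtain I
    where I: "I \<subseteq> K" "finite I" and "\<F> = (\<lambda>P. ?q ` (A P \<times> B P)) ` I"
    by (elim exE conjE)
  with \<F>(3) have cover: "K \<subseteq> (\<Union>P\<in>I. ?q ` (A P \<times> B P))"
    by simp
  let ?E = "\<lambda>C D. topspace M \<times> topspace M - (M closure_of C) \<times> (M closure_of D)"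
  \<comment> \<open>\<open>?V1\<close> and \<open>?V2\<close> exclude the two ways of matching an
    ordered \<open>(x, y)\<close> with the factors \<open>A P\<close> and
    \<open>B P\<close>.\<close>
  let ?V1 = "topspace M \<times> topspace M \<inter> (\<Inter>P\<in>I. ?E (A P) (B P))"
  let ?V2 = "topspace M \<times> topspace M \<inter> (\<Inter>P\<in>I. ?E (B P) (A P))"
  have "entourage M (?E (A P) (B P))" "entourage M (?E (B P) (A P))" if "P \<in> I" for P
    using that subsetD[OF I(1) that] AB[of P]
    by (intro entourage_closed_complement; simp add: Int_commute)+
  then have "entourage M ?V1" "entourage M ?V2"
    using I(2) by (simp_all only: entourage_Inter)
  then have ent: "entourage M (?V1 \<inter> ?V2)"
    by (rule entourage_Int)
  show thesis
  proof (rule that[OF ent])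
    show "(x, y) \<notin> ?V1 \<inter> ?V2" if xy: "{x, y} \<in> K" for x y
    proof -
      from subsetD[OF cover xy] obtain P where P: "P \<in> I" "{x, y} \<in> ?q ` (A P \<times> B P)"
        by (rule UN_E)
      then obtain s t where st: "s \<in> A P" "t \<in> B P" "{x, y} = {s, t}"
        by auto
      have "A P \<subseteq> M closure_of A P" "B P \<subseteq> M closure_of B P"
        using AB[OF subsetD[OF I(1) P(1)]] by (simp_all add: closure_of_subset openin_subset)
      moreover have "x = s \<and> y = t \<or> x = t \<and> y = s"
        using st(3) by (simp add: doubleton_eq_iff)
      ultimately have "(x, y) \<notin> ?E (A P) (B P) \<or> (x, y) \<notin> ?E (B P) (A P)"
        using st(1,2) by auto
      then show ?thesis
        using P(1) by blast
    qed
  qed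
qed

section \<open>Sequences in a convergence group\<close>

text \<open>Choose successively, avoiding the finitely many earlier values. With \<open>S i\<close>
  a set of elements of index at least \<open>i\<close>, this yields distinct group elements whose
  indices tend to infinity, ready for the convergence property.\<close>

lemma distinct_choice:
  fixes S :: "nat \<Rightarrow> 'b set"
  assumes "\<And>i. infinite (S i)"
  obtains h where "inj h" "\<And>i. h i \<in> S i"
proof -
  have "\<exists>h. \<forall>i::nat. h i \<in> S i - h ` {..<i}"
  proof (rule dependent_wellorder_choice)
    show "\<exists>r. r \<in> S i - h ` {..<i}" for i and h :: "nat \<Rightarrow> 'b"
    proof -
      have "infinite (S i - h ` {..<i})"
        using assms by (intro Diff_infinite_finite) auto
      then show ?thesis
        using infinite_imp_nonempty[of "S i - h ` {..<i}"] by auto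
    qed
    show "(r \<in> S i - h ` {..<i}) = (r \<in> S i - g ` {..<i})"
      if "\<And>y. y < i \<Longrightarrow> h y = g y" for r i and h g :: "nat \<Rightarrow> 'b"
    proof -
      have "h ` {..<i} = g ` {..<i}"
        using that by (intro image_cong) auto
      then show ?thesis
        by simp
    qed
  qed
  then obtain h where h: "\<And>i. h i \<in> S i - h ` {..<i}"
    by blast
  show thesis
  proof
    show "inj h"
    proof (rule linorder_injI)
      fix i j :: nat assume "i < j"
      then have "h i \<in> h ` {..<j}"
        by auto
      then show "h i \<noteq> h j"
        using h[of j] by auto
    qed
    show "h i \<in> S i" for i
      using h by blast
  qed
qed

lemma not_eventually_subseq:
  assumes "\<not> (\<forall>\<^sub>F n in sequentially. P n)"
  obtains t :: "nat \<Rightarrow> nat" where "strict_mono t" "\<And>n. \<not> P (t n)"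
proof -
  have "infinite {n. \<not> P n}"
    using assms unfolding cofinite_eq_sequentially[symmetric] eventually_cofinite by simp
  then show thesis
    using infinite_enumerate that by blast
qed

section \<open>The action and its convergence sequences\<close>

context convergence_action
begin

lemma separate_points:
  assumes "x \<in> topspace M" "y \<in> topspace M" "x \<noteq> y"
  obtains U V where "openin M U" "openin M V" "x \<in> U" "y \<in> V" "U \<inter> V = {}"
  using Hausdorff assms unfolding Hausdorff_space_def disjnt_def by meson

lemma group_G: "group G"
  using group_hom group_hom.axioms(1) by blast

lemma act_closed [simp]: "g \<in> carrier G \<Longrightarrow> x \<in> topspace M \<Longrightarrow> \<phi> g x \<in> topspace M"
  using element_image by blast

lemma act_inv [simp]:
  assumes "g \<in> carrier G" "x \<in> topspace M"
  shows "\<phi> (inv g) (\<phi> g x) = x" "\<phi> g (\<phi> (inv g) x) = x"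
proof -
  interpret group G by (rule group_G)
  show "\<phi> (inv g) (\<phi> g x) = x"
    using assms orbit_sym_aux by blast
  show "\<phi> g (\<phi> (inv g) x) = x"
    using assms orbit_sym_aux[of "inv g" x] by simp
qed

lemma act_eq_iff [simp]:
  "g \<in> carrier G \<Longrightarrow> x \<in> topspace M \<Longrightarrow> y \<in> topspace M \<Longrightarrow> \<phi> g x = \<phi> g y \<longleftrightarrow> x = y"
  by (metis act_inv(1))

lemma openin_act_image: "g \<in> carrier G \<Longrightarrow> openin M U \<Longrightarrow> openin M (\<phi> g ` U)"
  using homeomorphic homeomorphic_imp_open_map open_map_def by blast

lemma compactin_act_image: "g \<in> carrier G \<Longrightarrow> compactin M C \<Longrightarrow> compactin M (\<phi> g ` C)"
  using homeomorphic homeomorphic_imp_continuous_map image_compactin by blast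

text \<open>In this form the roles of the attracting and the repelling point are symmetric under
  inversion.\<close>

lemma convergence_sequence_iff:
  "convergence_sequence M \<phi> g b a \<longleftrightarrow> a \<in> topspace M \<and> b \<in> topspace M \<and>
     (\<forall>U W. openin M U \<and> b \<in> U \<and> openin M W \<and> a \<in> W \<longrightarrow>
        (\<forall>\<^sub>F n in sequentially. \<phi> (g n) ` (topspace M - W) \<subseteq> U))"
proof safe
  assume conv: "convergence_sequence M \<phi> g b a"
  then show a: "a \<in> topspace M" and "b \<in> topspace M"
    by (auto simp: convergence_sequence_def)
  fix U W assume UW: "openin M U" "b \<in> U" "openin M W" "a \<in> W"
  have "openin M (topspace M - {a})"
    using Hausdorff a by (simp add: Hausdorff_imp_t1_space closedin_t1_singleton openin_diff)
  then have "\<exists>V. openin M V \<and> x \<in> V \<and> (\<forall>\<^sub>F n in sequentially. \<phi> (g n) ` V \<subseteq> U)"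
    if "x \<in> topspace M - W" for x
    using that conv UW
    unfolding convergence_sequence_def locally_uniformly_to_def uniformly_to_def
    by (metis Diff_iff openin_open_subtopology singletonD)
  then obtain V where V: "\<And>x. x \<in> topspace M - W \<Longrightarrow>
      openin M (V x) \<and> x \<in> V x \<and> (\<forall>\<^sub>F n in sequentially. \<phi> (g n) ` V x \<subseteq> U)"
    by metis
  \<comment> \<open>Compactness turns local uniform convergence away from \<open>a\<close> into
    uniform convergence off \<open>W\<close>.\<close>
  have "compactin M (topspace M - W)"
    using closedin_compact_space[OF compact] UW(3) by auto
  then have "\<exists>\<F>. finite \<F> \<and> \<F> \<subseteq> V ` (topspace M - W) \<and> topspace M - W \<subseteq> \<Union>\<F>"
    by (rule compactinD) (use V in blast)+
  then obtain I where I: "finite I" "I \<subseteq> topspace M - W" "topspace M - W \<subseteq> (\<Union>x\<in>I. V x)"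
    by (metis (no_types, lifting) finite_subset_image)
  have "\<forall>\<^sub>F n in sequentially. \<forall>x\<in>I. \<phi> (g n) ` V x \<subseteq> U"
    using I V by (intro eventually_ball_finite) auto
  then show "\<forall>\<^sub>F n in sequentially. \<phi> (g n) ` (topspace M - W) \<subseteq> U"
    by (rule eventually_mono) (use I(3) in blast)
next
  assume a: "a \<in> topspace M" and b: "b \<in> topspace M"
    and *: "\<forall>U W. openin M U \<and> b \<in> U \<and> openin M W \<and> a \<in> W \<longrightarrow>
        (\<forall>\<^sub>F n in sequentially. \<phi> (g n) ` (topspace M - W) \<subseteq> U)"
  have "\<exists>V. openin (subtopology M (topspace M - {a})) V \<and> x \<in> V \<and>
      (\<forall>U. openin M U \<and> b \<in> U \<longrightarrow> (\<forall>\<^sub>F n in sequentially. \<phi> (g n) ` V \<subseteq> U))"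
    if x: "x \<in> topspace M - {a}" for x
  proof -
    obtain V W where VW: "openin M V" "openin M W" "x \<in> V" "a \<in> W" "V \<inter> W = {}"
      using separate_points[of x a] x a by auto
    have sub: "V \<subseteq> topspace M - W"
      using VW openin_subset[OF VW(1)] by auto
    then have "V = V \<inter> (topspace M - {a})"
      using VW by blast
    then have "openin (subtopology M (topspace M - {a})) V"
      using VW(1) openin_subtopology by blast
    moreover have "\<forall>\<^sub>F n in sequentially. \<phi> (g n) ` V \<subseteq> U" if "openin M U" "b \<in> U" for U
    proof -
      have "\<forall>\<^sub>F n in sequentially. \<phi> (g n) ` (topspace M - W) \<subseteq> U"
        using *[rule_format, of U W] that VW by simp
      then show ?thesis
        by (rule eventually_mono) (use sub in blast)
    qed
    ultimately show ?thesis
      using VW(3) by blast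
  qed
  then show "convergence_sequence M \<phi> g b a"
    using a b unfolding convergence_sequence_def locally_uniformly_to_def uniformly_to_def by blast
qed

lemma convergence_sequenceD:
  assumes "convergence_sequence M \<phi> g b a"
  shows "a \<in> topspace M" "b \<in> topspace M"
    and "openin M U \<Longrightarrow> b \<in> U \<Longrightarrow> openin M W \<Longrightarrow> a \<in> W \<Longrightarrow>
      \<forall>\<^sub>F n in sequentially. \<phi> (g n) ` (topspace M - W) \<subseteq> U"
  using assms unfolding convergence_sequence_iff by blast+

text \<open>Stated for any \<open>r\<close> tending to infinity, since the reindexings obtained
  through \<open>distinct_choice\<close> need not be increasing.\<close>

lemma convergence_sequence_subseq:
  assumes "convergence_sequence M \<phi> g b a" "filterlim r sequentially sequentially"
  shows "convergence_sequence M \<phi> (\<lambda>n. g (r n)) b a"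
  using assms(1) eventually_compose_filterlim[OF _ assms(2)]
  unfolding convergence_sequence_iff by fast

text \<open>A bijection maps the complement of \<open>U\<close> into \<open>W\<close> exactly when
  its inverse maps the complement of \<open>W\<close> into \<open>U\<close>.\<close>

lemma convergence_sequence_inverse:
  assumes conv: "convergence_sequence M \<phi> g b a" and g: "range g \<subseteq> carrier G"
  shows "convergence_sequence M \<phi> (\<lambda>n. inv (g n)) a b"
  unfolding convergence_sequence_iff
proof (intro conjI allI impI)
  show "b \<in> topspace M" "a \<in> topspace M"
    using convergence_sequenceD[OF conv] by auto
  fix U W assume UW: "openin M U \<and> a \<in> U \<and> openin M W \<and> b \<in> W"
  have "\<forall>\<^sub>F n in sequentially. \<phi> (g n) ` (topspace M - U) \<subseteq> W"
    using convergence_sequenceD(3)[OF conv] UW by blast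
  then show "\<forall>\<^sub>F n in sequentially. \<phi> (inv (g n)) ` (topspace M - W) \<subseteq> U"
  proof eventually_elim
    case (elim n)
    interpret group G by (rule group_G)
    have gn: "g n \<in> carrier G"
      using g by auto
    show ?case
    proof (rule image_subsetI, rule ccontr)
      fix x assume x: "x \<in> topspace M - W" and "\<phi> (inv (g n)) x \<notin> U"
      moreover have "\<phi> (inv (g n)) x \<in> topspace M"
        using x gn by simp
      ultimately have "\<phi> (g n) (\<phi> (inv (g n)) x) \<in> W"
        using subsetD[OF elim imageI] by (metis DiffI)
      then show False
        using x gn by simp
    qed
  qed
qed

text \<open>A neighbourhood of \<open>\<phi> (inv k) a\<close> is carried by \<open>k\<close> to a
  neighbourhood of \<open>a\<close>. This serves to follow an orbit point
  \<open>\<phi> k \<xi>\<close> along \<open>g n\<close> as the point \<xi> along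
  \<open>g n \<otimes> k\<close>.\<close>

lemma convergence_sequence_mult_right:
  assumes conv: "convergence_sequence M \<phi> g b a" and g: "range g \<subseteq> carrier G"
    and k: "k \<in> carrier G"
  shows "convergence_sequence M \<phi> (\<lambda>n. g n \<otimes> k) b (\<phi> (inv k) a)"
  unfolding convergence_sequence_iff
proof (intro conjI allI impI)
  interpret group G by (rule group_G)
  note ab = convergence_sequenceD(1,2)[OF conv]
  show "b \<in> topspace M" "\<phi> (inv k) a \<in> topspace M"
    using ab k by auto
  fix U W assume UW: "openin M U \<and> b \<in> U \<and> openin M W \<and> \<phi> (inv k) a \<in> W"
  then have "openin M (\<phi> k ` W)" "a \<in> \<phi> k ` W"
    using k ab by (auto intro: openin_act_image intro!: image_eqI[of a "\<phi> k" "\<phi> (inv k) a"])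
  then have "\<forall>\<^sub>F n in sequentially. \<phi> (g n) ` (topspace M - \<phi> k ` W) \<subseteq> U"
    using convergence_sequenceD(3)[OF conv] UW by blast
  then show "\<forall>\<^sub>F n in sequentially. \<phi> (g n \<otimes> k) ` (topspace M - W) \<subseteq> U"
  proof eventually_elim
    case (elim n)
    show ?case
    proof (rule image_subsetI)
      fix x assume x: "x \<in> topspace M - W"
      have "\<phi> k x \<notin> \<phi> k ` W"
        using x k UW openin_subset[of M W] by (auto simp: subset_iff)
      moreover have "\<phi> (g n \<otimes> k) x = \<phi> (g n) (\<phi> k x)"
        using x k g by (intro composition_rule) auto
      ultimately show "\<phi> (g n \<otimes> k) x \<in> U"
        using elim x k by auto
    qed
  qed
qed

lemma convergence_sequence_pointwise:
  assumes conv: "convergence_sequence M \<phi> g b a"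
    and x: "x \<in> topspace M" "x \<noteq> a"
  shows "limitin M (\<lambda>n. \<phi> (g n) x) b sequentially"
  unfolding limitin_def
proof (intro conjI allI impI)
  note ab = convergence_sequenceD(1,2)[OF conv]
  then show "b \<in> topspace M"
    by simp
  fix U assume U: "openin M U \<and> b \<in> U"
  obtain V W where "openin M W" "a \<in> W" "x \<in> V" "V \<inter> W = {}"
    using separate_points[of x a] x ab by metis
  then have "x \<notin> W"
    by auto
  have "\<forall>\<^sub>F n in sequentially. \<phi> (g n) ` (topspace M - W) \<subseteq> U"
    using convergence_sequenceD(3)[OF conv] U \<open>openin M W\<close> \<open>a \<in> W\<close> by blast
  then show "\<forall>\<^sub>F n in sequentially. \<phi> (g n) x \<in> U"
    by (rule eventually_mono) (use x \<open>x \<notin> W\<close> in auto)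
qed

lemma convergence_subseq:
  assumes "range s \<subseteq> carrier G" "inj s"
  obtains r a b where "strict_mono (r :: nat \<Rightarrow> nat)" "convergence_sequence M \<phi> (\<lambda>n. s (r n)) b a"
  using convergence[OF assms] unfolding comp_def by blast

text \<open>The compactum need not be sequentially compact, but sequences in a single orbit behave as if
  it were. With \<open>c i = g i x\<close>, the elements \<open>h i = g i (g (m i))\<^sup>-\<^sup>1\<close> satisfy \<open>h i (c (m i)) = c i\<close>;
  if they converge to \<open>b\<close> away from \<open>a\<close>, then either \<open>c (m i)\<close> tends to \<open>a\<close> or a subsequence of
  \<open>c i\<close> tends to \<open>b\<close>.\<close>

lemma orbit_convergent_subseq:
  assumes g: "range g \<subseteq> carrier G" "inj g" and x: "x \<in> topspace M"
  obtains r c where "filterlim r sequentially sequentially"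
    "limitin M (\<lambda>n. \<phi> (g (r n)) x) c sequentially"
proof -
  interpret group G by (rule group_G)
  have gc [simp]: "g n \<in> carrier G" for n
    using g(1) by auto
  \<comment> \<open>For fixed \<open>i\<close> these elements are pairwise distinct, so
    \<open>h\<close> can be chosen injective with \<open>m i\<close> at least
    \<open>i\<close>.\<close>
  have "infinite ((\<lambda>m. g i \<otimes> inv (g m)) ` {i..})" for i
  proof -
    have "inj (\<lambda>m. g i \<otimes> inv (g m))"
      using inv_inj gc inj_onD[OF g(2)] by (intro injI) (auto dest: inj_onD)
    then show ?thesis
      by (metis finite_imageD infinite_Ici inj_on_subset subset_UNIV)
  qed
  then obtain h where h: "inj h" "\<And>i. h i \<in> (\<lambda>m. g i \<otimes> inv (g m)) ` {i..}"
    using distinct_choice[of "\<lambda>i. (\<lambda>m. g i \<otimes> inv (g m)) ` {i..}"] by blast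
  then obtain m where m: "\<And>i. m i \<ge> i" "\<And>i. h i = g i \<otimes> inv (g (m i))"
  proof -
    have "\<forall>i. \<exists>m. i \<le> m \<and> h i = g i \<otimes> inv (g m)"
      using h(2) by (auto simp: image_iff)
    then show ?thesis
      using that by metis
  qed
  have h_act: "\<phi> (h i) (\<phi> (g (m i)) x) = \<phi> (g i) x" for i
    using x by (simp add: m(2) composition_rule)
  have m_lim: "filterlim m sequentially sequentially"
    using m(1) by (intro filterlim_at_top_mono[OF filterlim_ident]) auto
  have "range h \<subseteq> carrier G"
    using m(2) by auto
  then obtain s a b where s: "strict_mono (s :: nat \<Rightarrow> nat)"
    and conv: "convergence_sequence M \<phi> (\<lambda>i. h (s i)) b a"
    using convergence_subseq h(1) by metis
  show thesis
  proof (cases "limitin M (\<lambda>i. \<phi> (g (m (s i))) x) a sequentially")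
    case True
    then show thesis
      using filterlim_compose[OF m_lim filterlim_subseq[OF s]] by (intro that)
  next
    case False
    then obtain W where W: "openin M W" "a \<in> W"
      and "\<not> (\<forall>\<^sub>F i in sequentially. \<phi> (g (m (s i))) x \<in> W)"
      using convergence_sequenceD(1)[OF conv] unfolding limitin_def by blast
    from not_eventually_subseq[OF this(3)] obtain t
      where t: "strict_mono (t :: nat \<Rightarrow> nat)" "\<And>i. \<phi> (g (m (s (t i)))) x \<notin> W"
      by blast
    have "limitin M (\<lambda>i. \<phi> (g (s (t i))) x) b sequentially"
      unfolding limitin_def
    proof (intro conjI allI impI)
      show "b \<in> topspace M"
        using convergence_sequenceD[OF conv] by simp
      fix U assume "openin M U \<and> b \<in> U"
      then have "\<forall>\<^sub>F i in sequentially. \<phi> (h (s i)) ` (topspace M - W) \<subseteq> U"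
        using convergence_sequenceD(3)[OF conv] W by blast
      from eventually_subseq[OF t(1) this]
      show "\<forall>\<^sub>F i in sequentially. \<phi> (g (s (t i))) x \<in> U"
      proof eventually_elim
        case (elim i)
        then have "\<phi> (h (s (t i))) (\<phi> (g (m (s (t i)))) x) \<in> U"
          using t(2)[of i] x by auto
        then show ?case
          by (simp add: h_act)
      qed
    qed
    then show thesis
      using filterlim_compose[OF filterlim_subseq[OF s] filterlim_subseq[OF t(1)]] by (intro that)
  qed
qed

text \<open>Only the case where \<xi> is itself the repelling point is at stake. If its images
  stayed off a neighbourhood of \<open>b\<close> infinitely often,
  \<open>orbit_convergent_subseq\<close> would give them a limit other than \<open>b\<close> along a
  subsequence, and \<xi> would be conical.\<close>

lemma not_conical_tendsto:
  assumes nc: "\<not> conical G M \<phi> \<xi>" and \<xi>: "\<xi> \<in> topspace M"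
    and g: "range g \<subseteq> carrier G" "inj g" and conv: "convergence_sequence M \<phi> g b a"
  shows "limitin M (\<lambda>n. \<phi> (g n) \<xi>) b sequentially"
proof (cases "a = \<xi>")
  case False
  then show ?thesis
    using convergence_sequence_pointwise[OF conv \<xi>] by blast
next
  case [simp]: True
  show ?thesis
  proof (rule ccontr)
    assume "\<not> ?thesis"
    then obtain U where U: "openin M U" "b \<in> U" "\<not> (\<forall>\<^sub>F n in sequentially. \<phi> (g n) \<xi> \<in> U)"
      using convergence_sequenceD(2)[OF conv] unfolding limitin_def by blast
    obtain t where t: "strict_mono (t :: nat \<Rightarrow> nat)" "\<And>n. \<phi> (g (t n)) \<xi> \<notin> U"
      using not_eventually_subseq[OF U(3)] by blast
    have "range (\<lambda>n. g (t n)) \<subseteq> carrier G" "inj (\<lambda>n. g (t n))"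
      using g inj_compose[OF g(2) strict_mono_imp_inj_on[OF t(1)]] by (auto simp: comp_def)
    then obtain r c where r: "filterlim r sequentially sequentially"
      and lim: "limitin M (\<lambda>n. \<phi> (g (t (r n))) \<xi>) c sequentially"
      using orbit_convergent_subseq[OF _ _ \<xi>, of "\<lambda>n. g (t n)"] by blast
    have "filterlim (\<lambda>n. t (r n)) sequentially sequentially"
      using filterlim_compose[OF filterlim_subseq[OF t(1)] r] by simp
    then have "convergence_sequence M \<phi> (\<lambda>n. g (t (r n))) b \<xi>"
      using convergence_sequence_subseq conv by auto
    moreover have "c \<noteq> b"
    proof
      assume "c = b"
      then have "\<forall>\<^sub>F n in sequentially. \<phi> (g (t (r n))) \<xi> \<in> U"
        using lim U unfolding limitin_def by blast
      then show False
        using t(2) by simp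
    qed
    ultimately have "conical G M \<phi> \<xi>"
      using lim g(1) \<xi> unfolding conical_def by (intro conjI exI[of _ "\<lambda>n. g (t (r n))"]) blast+
    then show False
      using nc by simp
  qed
qed


section \<open>Points that are not conical\<close>

lemma orbit_subset: "x \<in> topspace M \<Longrightarrow> orbit G \<phi> x \<subseteq> topspace M"
  by (auto simp: orbit_def)

text \<open>Write \<eta> as \<open>\<phi> k \<xi>\<close>. Along a convergence sequence
  \<open>f n\<close> of distinct separating elements, \<open>not_conical_tendsto\<close> applies to
  both \<open>f n\<close> and \<open>f n \<otimes> k\<close>, so the images of \<xi> and \<eta>
  share the limit \<open>b\<close> and become \<open>V\<close>-close.\<close>

lemma finite_separating:
  assumes nc: "\<not> conical G M \<phi> \<xi>" and \<xi>: "\<xi> \<in> topspace M"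
    and \<eta>: "\<eta> \<in> orbit G \<phi> \<xi>" and V: "entourage M V"
  shows "finite {g \<in> carrier G. (\<phi> g \<xi>, \<phi> g \<eta>) \<notin> V}" (is "finite ?L")
proof (rule ccontr)
  interpret group G by (rule group_G)
  assume "infinite ?L"
  then obtain f :: "nat \<Rightarrow> _" where f: "inj f" "range f \<subseteq> ?L"
    using infinite_countable_subset by blast
  then have "range f \<subseteq> carrier G"
    by blast
  from convergence_subseq[OF this f(1)] obtain r a b where r: "strict_mono (r :: nat \<Rightarrow> nat)"
    and conv: "convergence_sequence M \<phi> (\<lambda>n. f (r n)) b a" .
  obtain k where k: "k \<in> carrier G" "\<eta> = \<phi> k \<xi>"
    using \<eta> by (auto simp: orbit_def)
  have fc [simp]: "f n \<in> carrier G" for n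
    using \<open>range f \<subseteq> carrier G\<close> by auto
  have inj: "inj (\<lambda>n. f (r n))"
    using inj_compose[OF f(1) strict_mono_imp_inj_on[OF r]] by (simp add: comp_def)
  have "inj (\<lambda>n. f (r n) \<otimes> k)"
  proof (rule injI)
    fix m n assume "f (r m) \<otimes> k = f (r n) \<otimes> k"
    then have "f (r m) = f (r n)"
      using k(1) by simp
    then show "m = n"
      using injD[OF inj] by blast
  qed
  moreover have "range (\<lambda>n. f (r n) \<otimes> k) \<subseteq> carrier G"
    using k(1) by auto
  moreover have "convergence_sequence M \<phi> (\<lambda>n. f (r n) \<otimes> k) b (\<phi> (inv k) a)"
    using k(1) by (intro convergence_sequence_mult_right[OF conv]) auto
  ultimately have "limitin M (\<lambda>n. \<phi> (f (r n) \<otimes> k) \<xi>) b sequentially"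
    using not_conical_tendsto[OF nc \<xi>] by blast
  then have 1: "limitin M (\<lambda>n. \<phi> (f (r n)) \<eta>) b sequentially"
    using \<xi> k by (simp add: composition_rule)
  have 2: "limitin M (\<lambda>n. \<phi> (f (r n)) \<xi>) b sequentially"
    using not_conical_tendsto[OF nc \<xi> _ inj conv] by (simp add: image_subset_iff)
  obtain N where N: "openin M N" "b \<in> N" "N \<times> N \<subseteq> V"
    using entourage_nhd[OF V] limitin_topspace[OF 1] by metis
  have "\<forall>\<^sub>F n in sequentially. \<phi> (f (r n)) \<eta> \<in> N" "\<forall>\<^sub>F n in sequentially. \<phi> (f (r n)) \<xi> \<in> N"
    using 1 2 N by (auto simp: limitin_def)
  then have "\<forall>\<^sub>F n in sequentially. False"
  proof eventually_elim
    case (elim n)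
    have "(\<phi> (f (r n)) \<xi>, \<phi> (f (r n)) \<eta>) \<in> V"
      using elim N(3) by blast
    then show ?case
      using f(2) by blast
  qed
  then show False
    by simp
qed

text \<open>For \<open>\<eta>\<close> in the orbit of \<open>\<xi>\<close>, let \<open>\<gamma> \<eta>\<close> be an element separating \<open>\<xi>\<close> from \<open>\<eta>\<close> for which the
  set \<open>B\<close> of points that it moves away from the image of \<open>\<xi>\<close> is maximal: geometrically, the first
  group element that a geodesic from \<open>\<xi>\<close> to \<open>\<eta>\<close> meets. If \<open>p n = \<gamma> (\<eta> n) \<xi>\<close> were infinitely many
  points, accumulating at \<open>b\<close>, then elements \<open>f n\<close> separating \<open>p n\<close> from \<open>p (Suc n)\<close> would have \<open>b\<close> as
  repelling point, and for \<open>j = n\<close> or \<open>j = Suc n\<close> the product of \<open>f n\<close> and \<open>\<gamma> (\<eta> j)\<close> would violate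
  maximality.\<close>

lemma finite_first_separating:
  assumes nc: "\<not> conical G M \<phi> \<xi>" and \<xi>: "\<xi> \<in> topspace M" and U: "entourage M U"
    and sep: "\<And>p q. p \<in> orbit G \<phi> \<xi> \<Longrightarrow> q \<in> orbit G \<phi> \<xi> \<Longrightarrow> p \<noteq> q \<Longrightarrow>
      \<exists>f\<in>carrier G. (\<phi> f p, \<phi> f q) \<notin> U"
  obtains V F where "entourage M V" "finite F" "F \<subseteq> orbit G \<phi> \<xi>"
    "\<And>\<eta>. \<eta> \<in> orbit G \<phi> \<xi> \<Longrightarrow> \<eta> \<noteq> \<xi> \<Longrightarrow> \<exists>g\<in>carrier G. \<phi> g \<xi> \<in> F \<and> (\<phi> g \<xi>, \<phi> g \<eta>) \<notin> V"
proof -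
  interpret group G by (rule group_G)
  \<comment> \<open>Two halvings are needed: \<open>U'\<close> splits a \<open>U\<close>-separation
    at the point \<open>b2\<close>, and \<open>V\<close> then allows \<open>b2\<close> to be
    replaced by any point near it.\<close>
  obtain U' where U': "entourage M U'" "sym U'" "U' O U' \<subseteq> U"
    using entourage_half[OF compact Hausdorff U] by blast
  obtain V where V: "entourage M V" "sym V" "V O V \<subseteq> U'"
    using entourage_half[OF compact Hausdorff U'(1)] by blast
  have half: "W \<subseteq> W'" if "entourage M W" "W O W \<subseteq> W'" for W W'
  proof
    fix p assume "p \<in> W"
    moreover from this have "p \<in> topspace M \<times> topspace M"
      using that(1) openin_subset[of "prod_topology M M" W] by (auto simp: entourage_def)
    then have "(snd p, snd p) \<in> W"
      using that(1) by (auto simp: entourage_def)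
    ultimately show "p \<in> W'"
      using that(2) by (cases p) auto
  qed
  have "V \<subseteq> U"
    using half[OF V(1,3)] half[OF U'(1,3)] by blast
  define O\<xi> where "O\<xi> = orbit G \<phi> \<xi> - {\<xi>}"
  define L where "L = (\<lambda>\<eta>. {g \<in> carrier G. (\<phi> g \<xi>, \<phi> g \<eta>) \<notin> V})"
  define B where "B = (\<lambda>g. {y \<in> topspace M. (\<phi> g y, \<phi> g \<xi>) \<notin> V})"
  have orb_act: "\<phi> g \<xi> \<in> orbit G \<phi> \<xi>" if "g \<in> carrier G" for g
    using that by (auto simp: orbit_def)
  \<comment> \<open>A maximal \<open>B g\<close> exists because \<open>L \<eta>\<close> is finite by
    \<open>finite_separating\<close> and nonempty by \<open>sep\<close>.\<close>
  have "\<exists>g\<in>L \<eta>. \<forall>k\<in>L \<eta>. \<not> B g \<subset> B k" if \<eta>: "\<eta> \<in> O\<xi>" for \<eta>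
  proof -
    have fin: "finite (B ` L \<eta>)"
      using finite_separating[OF nc \<xi> _ V(1)] \<eta> unfolding L_def O\<xi>_def by blast
    have "\<exists>f\<in>carrier G. (\<phi> f \<xi>, \<phi> f \<eta>) \<notin> U"
      using sep[of \<xi> \<eta>] orbit_refl[OF \<xi>] \<eta> unfolding O\<xi>_def by blast
    then have ne: "B ` L \<eta> \<noteq> {}"
      using \<open>V \<subseteq> U\<close> unfolding L_def by blast
    show ?thesis
      using finite_has_maximal[OF fin ne] by blast
  qed
  then obtain \<gamma> where \<gamma>: "\<And>\<eta>. \<eta> \<in> O\<xi> \<Longrightarrow> \<gamma> \<eta> \<in> L \<eta>"
    "\<And>\<eta> k. \<eta> \<in> O\<xi> \<Longrightarrow> k \<in> L \<eta> \<Longrightarrow> \<not> B (\<gamma> \<eta>) \<subset> B k"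
    by metis
  define F where "F = (\<lambda>\<eta>. \<phi> (\<gamma> \<eta>) \<xi>) ` O\<xi>"
  have "finite F"
  proof (rule ccontr)
    assume "infinite F"
    then obtain p :: "nat \<Rightarrow> 'a" where p: "inj p" "range p \<subseteq> F"
      using infinite_countable_subset by blast
    have "\<forall>n. \<exists>\<eta>\<in>O\<xi>. p n = \<phi> (\<gamma> \<eta>) \<xi>"
      using p(2) unfolding F_def by blast
    then obtain \<eta> where \<eta>: "\<And>n. \<eta> n \<in> O\<xi>" "\<And>n. p n = \<phi> (\<gamma> (\<eta> n)) \<xi>"
      by metis
    have \<gamma>c: "\<gamma> (\<eta> n) \<in> carrier G" for n
      using \<gamma>(1)[OF \<eta>(1)] unfolding L_def by blast
    have inj: "inj (\<lambda>n. \<gamma> (\<eta> n))"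
      using p(1) \<eta>(2) by (metis injD injI)
    have "range (\<lambda>n. \<gamma> (\<eta> n)) \<subseteq> carrier G"
      using \<gamma>c by blast
    from convergence_subseq[OF this inj] obtain r a b where r: "strict_mono (r :: nat \<Rightarrow> nat)"
      and conv: "convergence_sequence M \<phi> (\<lambda>n. \<gamma> (\<eta> (r n))) b a" .
    define g where "g = (\<lambda>n. \<gamma> (\<eta> (r n)))"
    define P where "P = (\<lambda>n. p (r n))"
    have gc [simp]: "g n \<in> carrier G" for n
      using \<gamma>c by (simp add: g_def)
    have P_eq: "P n = \<phi> (g n) \<xi>" for n
      by (simp add: P_def g_def \<eta>(2))
    have PX [simp]: "P n \<in> topspace M" for n
      using \<xi> by (simp add: P_eq)
    have "inj P"
      using inj_compose[OF p(1) strict_mono_imp_inj_on[OF r]] by (simp add: comp_def P_def)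
    then have "inj g"
      using P_eq by (metis injD injI)
    have "range g \<subseteq> carrier G"
      by auto
    then have P_lim: "limitin M P b sequentially"
      using not_conical_tendsto[OF nc \<xi> _ \<open>inj g\<close>, of b a] conv unfolding g_def[symmetric]
      by (simp add: P_eq[abs_def])
    then have b: "b \<in> topspace M"
      by (rule limitin_topspace)
    have P_ev: "\<forall>\<^sub>F n in sequentially. P n \<in> N" "\<forall>\<^sub>F n in sequentially. P (Suc n) \<in> N"
      if "openin M N" "b \<in> N" for N
    proof -
      show 1: "\<forall>\<^sub>F n in sequentially. P n \<in> N"
        using P_lim that unfolding limitin_def by blast
      show "\<forall>\<^sub>F n in sequentially. P (Suc n) \<in> N"
        using 1 eventually_sequentially_Suc[of "\<lambda>n. P n \<in> N"] by blast
    qed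
    have "\<exists>f\<in>carrier G. (\<phi> f (P n), \<phi> f (P (Suc n))) \<notin> U" for n
      using injD[OF \<open>inj P\<close>, of n "Suc n"] by (intro sep) (auto simp: P_eq orb_act)
    then obtain f where f [simp]: "\<And>n. f n \<in> carrier G"
      and f_sep: "\<And>n. (\<phi> (f n) (P n), \<phi> (f n) (P (Suc n))) \<notin> U"
      by metis
    \<comment> \<open>A value \<open>?v\<close> taken infinitely often is continuous at
      \<open>b\<close>; as \<open>P n\<close> and \<open>P (Suc n)\<close> both tend to
      \<open>b\<close>, it could not keep their images \<open>U\<close>-apart.\<close>
    have "infinite (f ` {i..})" for i
    proof
      assume "finite (f ` {i..})"
      then obtain n0 where n0: "infinite {n \<in> {i..}. f n = f n0}"
        using pigeonhole_infinite[OF infinite_Ici] by blast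
      let ?v = "f n0"
      obtain N where N: "openin M N" "\<phi> ?v b \<in> N" "N \<times> N \<subseteq> U"
        using entourage_nhd[OF U, of "\<phi> ?v b"] b by auto
      let ?N' = "\<phi> (inv ?v) ` N"
      have "openin M ?N'" "b \<in> ?N'"
        using N b by (auto intro: openin_act_image intro!: image_eqI[of b _ "\<phi> ?v b"])
      from eventually_conj[OF P_ev[OF this]]
      obtain m where m: "\<And>n. n \<ge> m \<Longrightarrow> P n \<in> ?N' \<and> P (Suc n) \<in> ?N'"
        unfolding eventually_sequentially by blast
      obtain n where n: "n \<ge> m" "f n = ?v"
        using n0 unfolding infinite_nat_iff_unbounded_le by blast
      have v: "\<phi> ?v y \<in> N" if "y \<in> ?N'" for y
        using that N(1) openin_subset[of M N] by (auto simp: subset_iff)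
      have "(\<phi> (f n) (P n), \<phi> (f n) (P (Suc n))) \<in> U"
        using v m[OF n(1)] N(3) unfolding n(2) by blast
      then show False
        using f_sep by blast
    qed
    then obtain h where h: "inj h" "\<And>i. h i \<in> f ` {i..}"
      using distinct_choice[of "\<lambda>i. f ` {i..}"] by blast
    have "\<forall>i. \<exists>m. i \<le> m \<and> h i = f m"
      using h(2) by (auto simp: image_iff)
    then obtain m where m: "\<And>i. i \<le> m i" "\<And>i. h i = f (m i)"
      by metis
    have "range h \<subseteq> carrier G"
      using m(2) by auto
    from convergence_subseq[OF this h(1)] obtain s a2 b2 where s: "strict_mono (s :: nat \<Rightarrow> nat)"
      and "convergence_sequence M \<phi> (\<lambda>i. h (s i)) b2 a2" .
    moreover define u where "u = (\<lambda>i. m (s i))"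
    ultimately have conv2: "convergence_sequence M \<phi> (\<lambda>i. f (u i)) b2 a2"
      by (simp add: m(2))
    note ab2 = convergence_sequenceD(1,2)[OF conv2]
    have "filterlim m sequentially sequentially"
      using m(1) by (intro filterlim_at_top_mono[OF filterlim_ident]) auto
    then have u: "filterlim u sequentially sequentially"
      unfolding u_def by (rule filterlim_compose[OF _ filterlim_subseq[OF s]])
    note Pu = P_ev[THEN eventually_compose_filterlim[OF _ u]]
    \<comment> \<open>With another repelling point, \<open>P (u i)\<close> and
      \<open>P (Suc (u i))\<close> would both be carried close to \<open>b2\<close>, hence
      \<open>U\<close>-close to each other.\<close>
    have "a2 = b"
    proof (rule ccontr)
      assume "a2 \<noteq> b"
      then obtain W N where WN: "openin M W" "openin M N" "a2 \<in> W" "b \<in> N" "W \<inter> N = {}"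
        using separate_points[OF ab2(1) b] by blast
      obtain N2 where N2: "openin M N2" "b2 \<in> N2" "N2 \<times> N2 \<subseteq> U"
        using entourage_nhd[OF U ab2(2)] by blast
      have "\<forall>\<^sub>F i in sequentially. \<phi> (f (u i)) ` (topspace M - W) \<subseteq> N2"
        using convergence_sequenceD(3)[OF conv2 N2(1,2) WN(1,3)] .
      with Pu[OF WN(2,4)] have "\<forall>\<^sub>F i in sequentially. False"
      proof eventually_elim
        case (elim i)
        have "P (u i) \<in> topspace M - W" "P (Suc (u i)) \<in> topspace M - W"
          using elim WN(5) by auto
        then have "(\<phi> (f (u i)) (P (u i)), \<phi> (f (u i)) (P (Suc (u i)))) \<in> U"
          using elim(3) N2(3) by blast
        then show ?case
          using f_sep by blast
      qed
      then show False
        by simp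
    qed
    obtain N where N: "openin M N" "b \<in> N" "N \<times> N \<subseteq> V"
      using entourage_nhd[OF V(1) b] by blast
    obtain N2 where N2: "openin M N2" "b2 \<in> N2" "N2 \<times> N2 \<subseteq> V"
      using entourage_nhd[OF V(1) ab2(2)] by blast
    obtain j0 where j0: "P j0 \<in> N" "P (Suc j0) \<in> N"
      using eventually_happens'[OF sequentially_bot eventually_conj[OF P_ev[OF N(1,2)]]] by blast
    have "P j0 \<noteq> P (Suc j0)"
      using injD[OF \<open>inj P\<close>, of j0 "Suc j0"] by auto
    \<comment> \<open>This point, fixed before \<open>i\<close> and \<open>j\<close> are chosen,
      will make the inclusion \<open>B (g j) \<subset> B k\<close> strict: it is close to
      \<open>P j\<close>, but differs from the repelling point \<open>b\<close> and so is carried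
      into \<open>N2\<close>.\<close>
    then obtain z where z: "z \<in> N" "z \<in> topspace M" "z \<noteq> b"
      using j0 PX by metis
    have "limitin M (\<lambda>i. \<phi> (f (u i)) z) b2 sequentially"
      using convergence_sequence_pointwise[OF conv2 z(2)] z(3) \<open>a2 = b\<close> by blast
    then have ev_z: "\<forall>\<^sub>F i in sequentially. \<phi> (f (u i)) z \<in> N2"
      using N2 unfolding limitin_def by blast
    have ev: "\<forall>\<^sub>F i in sequentially. \<phi> (f (u i)) ` (topspace M - N) \<subseteq> N2"
      using convergence_sequenceD(3)[OF conv2 N2(1,2) N(1)] N(2) \<open>a2 = b\<close> by blast
    obtain i where i: "\<phi> (f (u i)) z \<in> N2" "\<phi> (f (u i)) ` (topspace M - N) \<subseteq> N2"
      "P (u i) \<in> N" "P (Suc (u i)) \<in> N"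
      using eventually_happens'[OF sequentially_bot
          eventually_conj[OF eventually_conj[OF ev_z ev] eventually_conj[OF Pu[OF N(1,2)]]]]
      by blast
    let ?f = "f (u i)"
    \<comment> \<open>The images of the two points are \<open>U\<close>-apart, so they cannot both
      be \<open>U'\<close>-close to \<open>b2\<close>.\<close>
    have "\<exists>j\<in>{u i, Suc (u i)}. (\<phi> ?f (P j), b2) \<notin> U'"
    proof (rule ccontr)
      assume "\<not> ?thesis"
      then have "(\<phi> ?f (P (u i)), b2) \<in> U'" "(b2, \<phi> ?f (P (Suc (u i)))) \<in> U'"
        using symD[OF U'(2)] by auto
      then show False
        using f_sep[of "u i"] U'(3) by blast
    qed
    then obtain j where j: "P j \<in> N" "(\<phi> ?f (P j), b2) \<notin> U'"
      using i(3,4) by blast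
    \<comment> \<open>This product violates maximality of \<open>g j\<close>. Whatever
      \<open>g j\<close> moves \<open>V\<close>-far from \<open>P j\<close> lies outside
      \<open>N\<close>, so \<open>?f\<close> takes it into \<open>N2\<close>, all of whose points
      are \<open>V\<close>-far from \<open>\<phi> k \<xi>\<close>, that is, from
      \<open>\<phi> ?f (P j)\<close>.\<close>
    define k where "k = ?f \<otimes> g j"
    have k_act: "\<phi> k y = \<phi> ?f (\<phi> (g j) y)" if "y \<in> topspace M" for y
      using that by (simp add: k_def composition_rule)
    have far: "(\<phi> ?f (P j), w) \<notin> V" "(w, \<phi> ?f (P j)) \<notin> V" if w: "w \<in> N2" for w
    proof -
      have "(w, b2) \<in> V"
        using w N2 by blast
      then show "(\<phi> ?f (P j), w) \<notin> V"
        using j(2) V(3) by blast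
      then show "(w, \<phi> ?f (P j)) \<notin> V"
        using symD[OF V(2)] by blast
    qed
    have k_near: "\<phi> k y \<in> N2" if "y \<in> topspace M" "\<phi> (g j) y \<notin> N" for y
      using that i(2) by (auto simp: k_act)
    let ?\<eta> = "\<eta> (r j)"
    have \<eta>X: "?\<eta> \<in> topspace M"
      using \<eta>(1)[of "r j"] orbit_subset[OF \<xi>] unfolding O\<xi>_def by blast
    have "(P j, \<phi> (g j) ?\<eta>) \<notin> V"
      using \<gamma>(1)[OF \<eta>(1)[of "r j"]] unfolding L_def P_eq g_def by blast
    then have "\<phi> (g j) ?\<eta> \<notin> N"
      using j(1) N(3) by blast
    then have "(\<phi> k \<xi>, \<phi> k ?\<eta>) \<notin> V"
      using far(1)[OF k_near[OF \<eta>X]] \<xi> by (simp add: k_act P_eq)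
    moreover have "k \<in> carrier G"
      by (simp add: k_def)
    ultimately have "k \<in> L ?\<eta>"
      by (simp add: L_def)
    moreover have "B (g j) \<subset> B k"
    proof (rule psubsetI)
      show "B (g j) \<subseteq> B k"
      proof
        fix y assume y: "y \<in> B (g j)"
        then have "(\<phi> (g j) y, P j) \<notin> V" "y \<in> topspace M"
          by (auto simp: B_def P_eq)
        then have "\<phi> (g j) y \<notin> N"
          using j(1) N(3) by blast
        then have "(\<phi> k y, \<phi> ?f (P j)) \<notin> V"
          using far(2) k_near \<open>y \<in> topspace M\<close> by blast
        then show "y \<in> B k"
          using \<open>y \<in> topspace M\<close> \<xi> by (simp add: B_def k_act P_eq)
      qed
      let ?y = "\<phi> (inv (g j)) z"
      have y: "?y \<in> topspace M" "\<phi> (g j) ?y = z"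
        using z(2) by auto
      have "(z, P j) \<in> V"
        using z(1) j(1) N(3) by blast
      then have "?y \<notin> B (g j)"
        using y(2) by (simp add: B_def P_eq)
      moreover have "(\<phi> k ?y, \<phi> ?f (P j)) \<notin> V"
        using far(2)[OF i(1)] y by (simp add: k_act)
      then have "?y \<in> B k"
        using y(1) \<xi> by (simp add: B_def k_act P_eq)
      ultimately show "B (g j) \<noteq> B k"
        by blast
    qed
    ultimately show False
      using \<gamma>(2)[OF \<eta>(1)[of "r j"]] unfolding g_def by blast
  qed
  show thesis
  proof (rule that[OF V(1) \<open>finite F\<close>])
    show "F \<subseteq> orbit G \<phi> \<xi>"
      using \<gamma>(1) orb_act unfolding F_def L_def by blast
    show "\<exists>g\<in>carrier G. \<phi> g \<xi> \<in> F \<and> (\<phi> g \<xi>, \<phi> g \<eta>) \<notin> V"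
      if "\<eta> \<in> orbit G \<phi> \<xi>" "\<eta> \<noteq> \<xi>" for \<eta>
    proof -
      have "\<eta> \<in> O\<xi>"
        using that by (simp add: O\<xi>_def)
      then show ?thesis
        using \<gamma>(1) unfolding F_def L_def by blast
    qed
  qed
qed

end

section \<open>Minimality and bounded parabolicity\<close>

text \<open>Supplies the compact sets \<open>K\<close> for the conical and the bounded parabolic
  case; disjointness of the factors keeps the image off the diagonal.\<close>

lemma compactin_Theta2_Times:
  assumes "compactin M A" "compactin M B" "A \<inter> B = {}"
  shows "compactin (Theta2_topology M) ((\<lambda>(x, y). {x, y}) ` (A \<times> B))"
proof -
  let ?q = "\<lambda>(x, y). {x, y}"
  have "compactin (symmetric_square M) (?q ` (A \<times> B))"
  proof (rule image_compactin)
    show "compactin (prod_topology M M) (A \<times> B)"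
      using assms by (simp add: compactin_Times)
    show "continuous_map (prod_topology M M) (symmetric_square M) ?q"
      unfolding symmetric_square_def
      by (rule quotient_imp_continuous_map[OF quotient_map_quotient_topology])
  qed
  moreover have "?q ` (A \<times> B) \<subseteq> Theta2 (topspace M)"
  proof (rule image_subsetI)
    fix p assume "p \<in> A \<times> B"
    then have "fst p \<in> topspace M" "snd p \<in> topspace M" "fst p \<noteq> snd p"
      using assms(3) compactin_subset_topspace[OF assms(1)] compactin_subset_topspace[OF assms(2)]
      by auto
    then show "?q p \<in> Theta2 (topspace M)"
      by (auto simp: nsets_def case_prod_unfold)
  qed
  ultimately show ?thesis
    by (simp add: Theta2_topology_def compactin_subtopology)
qed

lemma translatesI: "h \<in> H \<Longrightarrow> x \<in> K \<Longrightarrow> \<psi> h x \<in> translates H \<psi> K"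
  unfolding translates_def by blast

section \<open>Consequences of minimality\<close>

locale minimal_convergence_action = convergence_action +
  assumes non_elem: "non_elementary G M \<phi>"
    and minimal: "topologically_minimal G M \<phi>"
begin

lemma two_points:
  obtains x y where "x \<in> topspace M" "y \<in> topspace M" "x \<noteq> a" "y \<noteq> a" "x \<noteq> y"
proof -
  have big: "infinite (topspace M) \<or> card (topspace M) > 2"
    using non_elem minimal unfolding non_elementary_def topologically_minimal_def by simp
  have "\<not> topspace M \<subseteq> {a, x}" for x
  proof
    assume sub: "topspace M \<subseteq> {a, x}"
    then have "finite (topspace M)"
      by (rule finite_subset) simp
    moreover have "card (topspace M) \<le> 2"
      using card_mono[OF _ sub] card_insert_le_m1[of 2 "{x}" a] by simp
    ultimately show False
      using big by simp
  qed
  then show thesis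
    using that by blast
qed

lemma attracting_point:
  assumes "w \<in> topspace M"
  obtains g a where "range g \<subseteq> carrier G" "convergence_sequence M \<phi> g w a"
  using assms minimal unfolding topologically_minimal_def limit_set_def by blast

text \<open>A sequence attracting to an isolated point would eventually send two distinct points
  exactly onto it, against injectivity.\<close>

lemma not_isolated:
  assumes x: "x \<in> topspace M"
  shows "\<not> openin M {x}"
proof
  assume op: "openin M {x}"
  obtain g a where g: "range g \<subseteq> carrier G" and conv: "convergence_sequence M \<phi> g x a"
    using attracting_point[OF x] .
  obtain y z where yz: "y \<in> topspace M" "z \<in> topspace M" "y \<noteq> a" "z \<noteq> a" "y \<noteq> z"
    using two_points[of a] .
  have "limitin M (\<lambda>n. \<phi> (g n) y) x sequentially" "limitin M (\<lambda>n. \<phi> (g n) z) x sequentially"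
    using convergence_sequence_pointwise[OF conv] yz by blast+
  then have "\<forall>\<^sub>F n in sequentially. \<phi> (g n) y \<in> {x}" "\<forall>\<^sub>F n in sequentially. \<phi> (g n) z \<in> {x}"
    using op unfolding limitin_def by blast+
  then have "\<forall>\<^sub>F n in sequentially. False"
  proof eventually_elim
    case (elim n)
    have "g n \<in> carrier G"
      using g by auto
    then show ?case
      using elim yz act_eq_iff[of "g n" y z] by simp
  qed
  then show False
    by simp
qed

section \<open>Orbit and stabilizer of a non-conical point\<close>

context
  fixes \<xi>
  assumes nc: "\<not> conical G M \<phi> \<xi>" and \<xi>: "\<xi> \<in> topspace M"
begin

text \<open>The images of \<xi> are constantly \<xi>. If \<open>b\<close> were different, then \<xi>
  would be conical when it is the repelling point, and otherwise the constant sequence would also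
  converge to \<open>b\<close>.\<close>

lemma stabilizer_attracting_point:
  assumes g: "range g \<subseteq> stabilizer G \<phi> \<xi>" and conv: "convergence_sequence M \<phi> g b a"
  shows "b = \<xi>"
proof (rule ccontr)
  assume "b \<noteq> \<xi>"
  have gc: "range g \<subseteq> carrier G" and fix_\<xi>: "\<phi> (g n) \<xi> = \<xi>" for n
    using g by (auto simp: stabilizer_def)
  have const: "limitin M (\<lambda>n. \<phi> (g n) \<xi>) \<xi> sequentially"
    using \<xi> by (simp add: fix_\<xi>)
  show False
  proof (cases "a = \<xi>")
    case True
    then have "conical G M \<phi> \<xi>"
      using gc conv const \<xi> \<open>b \<noteq> \<xi>\<close> unfolding conical_def by blast
    then show False
      using nc by simp
  next
    case False
    then have "limitin M (\<lambda>n. \<phi> (g n) \<xi>) b sequentially"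
      using convergence_sequence_pointwise[OF conv \<xi>] by blast
    then show False
      using limitin_Hausdorff_unique[OF _ const _ Hausdorff] \<open>b \<noteq> \<xi>\<close> by simp
  qed
qed

text \<open>If all of \<open>G\<close> fixed \<xi>, every attracting point would be \<xi>, and by
  minimality \<xi> would be the only point.\<close>

lemma orbit_nontrivial: obtains y where "y \<in> orbit G \<phi> \<xi>" "y \<noteq> \<xi>"
proof (cases "orbit G \<phi> \<xi> \<subseteq> {\<xi>}")
  case True
  then have "carrier G \<subseteq> stabilizer G \<phi> \<xi>"
    by (auto simp: orbit_def stabilizer_def)
  then have "w = \<xi>" if "w \<in> topspace M" for w
    using attracting_point[OF that] stabilizer_attracting_point by (metis order_trans)
  then show thesis
    using two_points[of \<xi>] by metis
next
  case False
  then show thesis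
    using that by blast
qed

text \<open>Every point \<open>w\<close> of \<open>W\<close> is attracting for some sequence, which
  moves any orbit point other than the repelling one into \<open>W\<close>. The orbit has two
  points, so one of them is available.\<close>

lemma orbit_dense:
  assumes W: "openin M W" "W \<noteq> {}"
  obtains y where "y \<in> orbit G \<phi> \<xi>" "y \<in> W"
proof -
  obtain w where w: "w \<in> W" "w \<in> topspace M"
    using W openin_subset by blast
  obtain g a where g: "range g \<subseteq> carrier G" and conv: "convergence_sequence M \<phi> g w a"
    using attracting_point[OF w(2)] .
  obtain y where y: "y \<in> orbit G \<phi> \<xi>" "y \<noteq> a"
    using orbit_nontrivial orbit_refl[OF \<xi>] by metis
  then have yX: "y \<in> topspace M"
    using orbit_subset[OF \<xi>] by blast
  have "limitin M (\<lambda>n. \<phi> (g n) y) w sequentially"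
    using convergence_sequence_pointwise[OF conv yX y(2)] .
  then have "\<forall>\<^sub>F n in sequentially. \<phi> (g n) y \<in> W"
    using W(1) w(1) unfolding limitin_def by blast
  then obtain n where n: "\<phi> (g n) y \<in> W"
    using eventually_happens'[OF sequentially_bot] by blast
  have gn: "g n \<in> carrier G"
    using g by auto
  have "\<phi> (g n) y \<in> orbit G \<phi> \<xi>"
    by (rule orbit_trans[OF \<xi> yX act_closed[OF gn yX] y(1)]) (use gn in \<open>auto simp: orbit_def\<close>)
  then show thesis
    using n that by blast
qed

text \<open>Infinitely many such elements would contain a convergence sequence with attracting and
  repelling point \<xi>. Taking the complements of \<open>C\<close> and \<open>D\<close> as
  neighbourhoods of \<xi>, it eventually moves \<open>C\<close> off \<open>D\<close>.\<close>

lemma stabilizer_properly_discontinuous: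
  assumes C: "closedin M C" "\<xi> \<notin> C" and D: "closedin M D" "\<xi> \<notin> D"
  shows "finite {h \<in> stabilizer G \<phi> \<xi>. \<phi> h ` C \<inter> D \<noteq> {}}" (is "finite ?H")
proof (rule ccontr)
  interpret group G by (rule group_G)
  assume "infinite ?H"
  then obtain f :: "nat \<Rightarrow> _" where f: "inj f" "range f \<subseteq> ?H"
    using infinite_countable_subset by blast
  then have fs: "range f \<subseteq> stabilizer G \<phi> \<xi>"
    by blast
  then have "range f \<subseteq> carrier G"
    using stabilizer_subset by blast
  from convergence_subseq[OF this f(1)] obtain r a b where r: "strict_mono (r :: nat \<Rightarrow> nat)"
    and conv: "convergence_sequence M \<phi> (\<lambda>n. f (r n)) b a" .
  have "range (\<lambda>n. f (r n)) \<subseteq> stabilizer G \<phi> \<xi>"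
    using fs by auto
  from stabilizer_attracting_point[OF this conv] have [simp]: "b = \<xi>" .
  have "range (\<lambda>n. f (r n)) \<subseteq> carrier G"
    using \<open>range f \<subseteq> carrier G\<close> by auto
  \<comment> \<open>Inversion makes \<open>a\<close> an attracting point of a sequence in the
    stabilizer, so \<open>a\<close> is \<xi> as well.\<close>
  from convergence_sequence_inverse[OF conv this]
  have conv': "convergence_sequence M \<phi> (\<lambda>n. inv (f (r n))) a b" .
  have "range (\<lambda>n. inv (f (r n))) \<subseteq> stabilizer G \<phi> \<xi>"
    using fs stabilizer_m_inv_closed[OF \<xi>] by auto
  from stabilizer_attracting_point[OF this conv'] have [simp]: "a = \<xi>" .
  have "\<forall>\<^sub>F n in sequentially. \<phi> (f (r n)) ` (topspace M - (topspace M - C)) \<subseteq> topspace M - D"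
    using C D \<xi> by (intro convergence_sequenceD(3)[OF conv]) auto
  then obtain n where n: "\<phi> (f (r n)) ` (topspace M - (topspace M - C)) \<subseteq> topspace M - D"
    using eventually_happens'[OF sequentially_bot] by blast
  have "topspace M - (topspace M - C) = C"
    using closedin_subset[OF C(1)] by blast
  with n have "\<phi> (f (r n)) ` C \<inter> D = {}"
    by auto
  then show False
    using f(2) by blast
qed

text \<open>Bringing the finitely many images in \<open>F\<close> back to \<xi> turns the first
  separating elements into stabilizer elements. This covers the orbit by stabilizer translates of
  one compact set, and density extends the cover to all points other than \<xi>.\<close>

lemma bounded_parabolic_if_separated:
  assumes U: "entourage M U"
    and sep: "\<And>p q. p \<in> orbit G \<phi> \<xi> \<Longrightarrow> q \<in> orbit G \<phi> \<xi> \<Longrightarrow> p \<noteq> q \<Longrightarrow>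
      \<exists>f\<in>carrier G. (\<phi> f p, \<phi> f q) \<notin> U"
  shows "bounded_parabolic G M \<phi> \<xi>"
proof -
  interpret group G by (rule group_G)
  let ?S = "stabilizer G \<phi> \<xi>"
  obtain V F where V: "entourage M V" and F: "finite F" "F \<subseteq> orbit G \<phi> \<xi>"
    "\<And>\<eta>. \<eta> \<in> orbit G \<phi> \<xi> \<Longrightarrow> \<eta> \<noteq> \<xi> \<Longrightarrow> \<exists>g\<in>carrier G. \<phi> g \<xi> \<in> F \<and> (\<phi> g \<xi>, \<phi> g \<eta>) \<notin> V"
    using finite_first_separating[OF nc \<xi> U sep] by blast
  have "\<forall>p\<in>F. \<exists>h\<in>carrier G. p = \<phi> h \<xi>"
    using F(2) by (auto simp: orbit_def)
  \<comment> \<open>If \<open>\<phi> g \<xi>\<close> is \<open>p\<close>, then \<open>g\<close> and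
    \<open>h p\<close> agree at \<xi>, so \<open>inv (h p) \<otimes> g\<close> lies in the
    stabilizer.\<close>
  then obtain h where h: "\<And>p. p \<in> F \<Longrightarrow> h p \<in> carrier G" "\<And>p. p \<in> F \<Longrightarrow> p = \<phi> (h p) \<xi>"
    by metis
  define Q where "Q = (\<lambda>p. {q \<in> topspace M. (p, q) \<notin> V})"
  \<comment> \<open>The points \<open>V\<close>-far from \<open>p\<close>, pulled back by
    \<open>h p\<close>; since \<open>p\<close> is pulled back to \<xi>, this set misses
    \<xi>.\<close>
  define C where "C = (\<Union>p\<in>F. \<phi> (inv (h p)) ` Q p)"
  have FX: "F \<subseteq> topspace M"
    using F(2) orbit_subset[OF \<xi>] by blast
  have C_compact: "compactin M C"
    unfolding C_def
  proof (rule compactin_Union)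
    show "compactin M S" if "S \<in> (\<lambda>p. \<phi> (inv (h p)) ` Q p) ` F" for S
    proof -
      obtain p where p: "p \<in> F" "S = \<phi> (inv (h p)) ` Q p"
        using \<open>S \<in> _\<close> by blast
      have "compactin M (Q p)"
        unfolding Q_def using p FX
        by (intro closedin_compact_space[OF compact] closedin_entourage_section[OF V]) auto
      then show ?thesis
        using p h(1) by (simp add: compactin_act_image)
    qed
  qed (use F in simp)
  have "\<xi> \<notin> C"
  proof
    assume "\<xi> \<in> C"
    then obtain p q where pq: "p \<in> F" "q \<in> Q p" "\<xi> = \<phi> (inv (h p)) q"
      unfolding C_def by blast
    then have "p = q"
      using h(1)[of p] h(2)[of p] by (auto simp: Q_def)
    then have "(p, p) \<notin> V" "p \<in> topspace M"
      using pq(2) by (auto simp: Q_def)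
    then show False
      using V by (auto simp: entourage_def)
  qed
  have C_closed: "closedin M C"
    using compactin_imp_closedin[OF Hausdorff C_compact] .
  have CX: "C \<subseteq> topspace M"
    using closedin_subset[OF C_closed] .
  have S_act: "\<phi> k \<xi> = \<xi>" "k \<in> carrier G" if "k \<in> ?S" for k
    using that by (auto simp: stabilizer_def)
  have cover: "\<exists>k\<in>?S. \<eta> \<in> \<phi> k ` C" if \<eta>: "\<eta> \<in> orbit G \<phi> \<xi>" "\<eta> \<noteq> \<xi>" for \<eta>
  proof -
    obtain g where g: "g \<in> carrier G" "\<phi> g \<xi> \<in> F" "(\<phi> g \<xi>, \<phi> g \<eta>) \<notin> V"
      using F(3)[OF \<eta>] by blast
    have \<eta>X: "\<eta> \<in> topspace M"
      using \<eta> orbit_subset[OF \<xi>] by blast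
    let ?p = "\<phi> g \<xi>"
    let ?k = "inv (h ?p) \<otimes> g"
    have hp: "h ?p \<in> carrier G" "\<phi> (h ?p) \<xi> = ?p"
      using h[OF g(2)] by simp_all
    have "\<phi> (inv (h ?p)) ?p = \<xi>"
      using act_inv(1)[OF hp(1) \<xi>] by (simp add: hp(2))
    then have k: "?k \<in> ?S"
      using g(1) hp(1) \<xi> by (simp add: stabilizer_def composition_rule)
    have "\<phi> g \<eta> \<in> Q ?p"
      using g \<eta>X by (simp add: Q_def)
    then have "\<phi> ?k \<eta> \<in> C"
      using g hp(1) \<eta>X unfolding C_def by (auto simp: composition_rule)
    then have "\<eta> \<in> \<phi> (inv ?k) ` C"
      using act_inv(1)[OF S_act(2)[OF k] \<eta>X] by (intro image_eqI[of _ _ "\<phi> ?k \<eta>"]) simp_all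
    then show ?thesis
      using stabilizer_m_inv_closed[OF \<xi> k] by blast
  qed
  have not_\<xi>: "\<xi> \<notin> \<phi> k ` C" if "k \<in> ?S" for k
  proof
    assume "\<xi> \<in> \<phi> k ` C"
    then obtain c where "c \<in> C" "\<phi> k \<xi> = \<phi> k c"
      unfolding S_act(1)[OF \<open>k \<in> ?S\<close>] by (rule imageE)
    then show False
      using act_eq_iff[OF S_act(2)[OF \<open>k \<in> ?S\<close>] \<xi>, of c] CX \<open>\<xi> \<notin> C\<close> by blast
  qed
  have closed: "closedin M (\<Union>k\<in>H. \<phi> k ` C)" if "finite H" "H \<subseteq> ?S" for H
  proof (rule closedin_Union)
    show "closedin M T" if T: "T \<in> (\<lambda>k. \<phi> k ` C) ` H" for T
    proof -
      obtain k where k: "k \<in> H" "T = \<phi> k ` C"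
        using T by blast
      then have "k \<in> carrier G"
        using \<open>H \<subseteq> ?S\<close> S_act(2) by blast
      then show ?thesis
        using compactin_imp_closedin[OF Hausdorff compactin_act_image[OF _ C_compact]] k(2) by simp
    qed
  qed (use that in simp)
  \<comment> \<open>With a finite stabilizer the translates of \<open>C\<close> would have a closed
    union, whose complement contains no orbit point but \<xi>. By density that open complement would
    be \<open>{\<xi>}\<close>, but \<xi> is not isolated.\<close>
  have inf_S: "infinite ?S"
  proof
    assume "finite ?S"
    define T where "T = (\<Union>k\<in>?S. \<phi> k ` C)"
    have "closedin M T"
      using closed[OF \<open>finite ?S\<close>] by (simp add: T_def)
    then have op: "openin M (topspace M - T)"
      by auto
    have "\<xi> \<in> topspace M - T"
      using not_\<xi> \<xi> by (auto simp: T_def)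
    moreover have "topspace M - T \<noteq> {\<xi>}"
      using op not_isolated[OF \<xi>] by metis
    ultimately have "topspace M - T - {\<xi>} \<noteq> {}"
      by blast
    moreover have "openin M (topspace M - T - {\<xi>})"
      using \<xi> Hausdorff
      by (intro openin_diff[OF op]) (simp add: closedin_Hausdorff_sing_eq)
    ultimately obtain y where "y \<in> orbit G \<phi> \<xi>" "y \<in> topspace M - T - {\<xi>}"
      using orbit_dense by metis
    then show False
      using cover[of y] by (auto simp: T_def)
  qed
  \<comment> \<open>Proper discontinuity leaves only finitely many translates of \<open>C\<close>
    that reach outside \<open>W\<close>, so their union \<open>T\<close> is closed. If \<eta> were
    not in \<open>T\<close>, some orbit point of \<open>N - T\<close> would be uncovered.\<close>
  have "\<exists>k\<in>?S. \<eta> \<in> \<phi> k ` C" if \<eta>: "\<eta> \<in> topspace M" "\<eta> \<noteq> \<xi>" for \<eta>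
  proof -
    obtain N W where NW: "openin M N" "openin M W" "\<eta> \<in> N" "\<xi> \<in> W" "N \<inter> W = {}"
      using separate_points[OF \<eta>(1) \<xi> \<eta>(2)] .
    let ?D = "topspace M - W"
    define H where "H = {k \<in> ?S. \<phi> k ` C \<inter> ?D \<noteq> {}}"
    have D: "closedin M ?D" "\<xi> \<notin> ?D"
      using NW by auto
    have "finite H"
      unfolding H_def by (rule stabilizer_properly_discontinuous[OF C_closed \<open>\<xi> \<notin> C\<close> D])
    have "H \<subseteq> ?S"
      by (auto simp: H_def)
    define T where "T = (\<Union>k\<in>H. \<phi> k ` C)"
    have "openin M (N - T)"
      using openin_diff[OF NW(1) closed[OF \<open>finite H\<close> \<open>H \<subseteq> ?S\<close>]] by (simp add: T_def)
    have "\<eta> \<in> T"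
    proof (rule ccontr)
      assume "\<eta> \<notin> T"
      then have "N - T \<noteq> {}"
        using NW(3) by blast
      then obtain y where y: "y \<in> orbit G \<phi> \<xi>" "y \<in> N - T"
        using orbit_dense[OF \<open>openin M (N - T)\<close>] by blast
      have "y \<in> ?D" "y \<noteq> \<xi>"
        using y NW openin_subset[OF NW(1)] by auto
      obtain k where k: "k \<in> ?S" "y \<in> \<phi> k ` C"
        using cover[OF y(1) \<open>y \<noteq> \<xi>\<close>] by blast
      then have "k \<in> H"
        using \<open>y \<in> ?D\<close> unfolding H_def by blast
      then show False
        using k(2) y(2) unfolding T_def by blast
    qed
    then show ?thesis
      using \<open>H \<subseteq> ?S\<close> unfolding T_def by blast
  qed
  moreover have "\<phi> k ` C \<subseteq> topspace M - {\<xi>}" if "k \<in> ?S" for k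
    using not_\<xi>[OF that] CX S_act(2)[OF that] by auto
  ultimately have "translates ?S \<phi> C = topspace M - {\<xi>}"
    unfolding translates_def by blast
  then have "cocompact_on M \<phi> ?S (topspace M - {\<xi>})"
    unfolding cocompact_on_def using C_compact CX \<open>\<xi> \<notin> C\<close> by blast
  moreover have "limit_set M \<phi> ?S = {\<xi>}"
  proof
    show "limit_set M \<phi> ?S \<subseteq> {\<xi>}"
      using stabilizer_attracting_point unfolding limit_set_def by blast
    obtain f :: "nat \<Rightarrow> _" where f: "inj f" "range f \<subseteq> ?S"
      using infinite_countable_subset[OF inf_S] by blast
    have "range f \<subseteq> carrier G"
      using f(2) stabilizer_subset by blast
    from convergence_subseq[OF this f(1)] obtain r a b where
      conv: "convergence_sequence M \<phi> (\<lambda>n. f (r n)) b a" .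
    moreover have rng: "range (\<lambda>n. f (r n)) \<subseteq> ?S"
      using f(2) by auto
    ultimately show "{\<xi>} \<subseteq> limit_set M \<phi> ?S"
      using stabilizer_attracting_point[OF rng conv] unfolding limit_set_def by blast
  qed
  ultimately show ?thesis
    using inf_S \<xi> unfolding bounded_parabolic_def parabolic_def by blast
qed

end

section \<open>The three conditions\<close>

text \<open>The second of the three conditions, with its compact set as a parameter.\<close>

definition separates_from_all where
  "separates_from_all \<xi> K \<longleftrightarrow> compactin (Theta2_topology M) K \<and>
     (\<forall>\<eta>\<in>topspace M - {\<xi>}. {\<xi>, \<eta>} \<in> translates (carrier G) (pair_action \<phi>) K)"

lemma separates_pairI:
  assumes "g \<in> carrier G" "x \<in> topspace M" "y \<in> topspace M" "{\<phi> g x, \<phi> g y} \<in> K"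
  shows "{x, y} \<in> translates (carrier G) (pair_action \<phi>) K"
proof -
  interpret group G by (rule group_G)
  have "pair_action \<phi> (inv g) {\<phi> g x, \<phi> g y} = {x, y}"
    using assms by simp
  then show ?thesis
    using assms unfolding translates_def by (metis UN_I imageI inv_closed)
qed

text \<open>Along the conical sequence \<xi> tends to \<open>c\<close> while every other point tends
  to \<open>b\<close>. Disjoint closed neighbourhoods of these two limits therefore serve all \<eta>
  at once.\<close>

lemma conical_imp_separates:
  assumes "conical G M \<phi> \<xi>"
  shows "\<exists>K. separates_from_all \<xi> K"
proof -
  obtain g b c where \<xi>: "\<xi> \<in> topspace M" and g: "range g \<subseteq> carrier G"
    and conv: "convergence_sequence M \<phi> g b \<xi>"
    and lim: "limitin M (\<lambda>n. \<phi> (g n) \<xi>) c sequentially" and "c \<noteq> b"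
    using assms unfolding conical_def by blast
  have "regular_space M"
    using compact_Hausdorff_imp_regular_space[OF compact Hausdorff] .
  then obtain A B where AB: "openin M A" "openin M B" "c \<in> A" "b \<in> B"
    "(M closure_of A) \<inter> (M closure_of B) = {}"
    using Hausdorff_separate_closures[OF _ Hausdorff limitin_topspace[OF lim]
        convergence_sequenceD(2)[OF conv] \<open>c \<noteq> b\<close>] by blast
  let ?K = "(\<lambda>(x, y). {x, y}) ` ((M closure_of A) \<times> (M closure_of B))"
  have "compactin (Theta2_topology M) ?K"
    using AB(5) by (intro compactin_Theta2_Times closedin_compact_space[OF compact]) auto
  moreover have "{\<xi>, \<eta>} \<in> translates (carrier G) (pair_action \<phi>) ?K"
    if \<eta>: "\<eta> \<in> topspace M - {\<xi>}" for \<eta>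
  proof -
    have \<eta>': "\<eta> \<in> topspace M" "\<eta> \<noteq> \<xi>"
      using \<eta> by auto
    have "\<forall>\<^sub>F n in sequentially. \<phi> (g n) \<xi> \<in> A"
      using lim AB unfolding limitin_def by blast
    moreover have "\<forall>\<^sub>F n in sequentially. \<phi> (g n) \<eta> \<in> B"
      using convergence_sequence_pointwise[OF conv \<eta>'] AB unfolding limitin_def by blast
    ultimately have "\<forall>\<^sub>F n in sequentially. \<phi> (g n) \<xi> \<in> A \<and> \<phi> (g n) \<eta> \<in> B"
      by (rule eventually_conj)
    then obtain n where n: "\<phi> (g n) \<xi> \<in> A" "\<phi> (g n) \<eta> \<in> B"
      using eventually_happens'[OF sequentially_bot] by blast
    have "A \<subseteq> M closure_of A" "B \<subseteq> M closure_of B"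
      using AB by (simp_all add: closure_of_subset openin_subset)
    with n have "{\<phi> (g n) \<xi>, \<phi> (g n) \<eta>} \<in> ?K"
      by (intro image_eqI[of _ _ "(\<phi> (g n) \<xi>, \<phi> (g n) \<eta>)"]) auto
    moreover have "g n \<in> carrier G"
      using g by auto
    ultimately show ?thesis
      by (intro separates_pairI[OF _ \<xi> \<eta>'(1)])
  qed
  ultimately show ?thesis
    unfolding separates_from_all_def by blast
qed

text \<open>Stabilizer elements fix \<xi> while their translates of \<open>C\<close> exhaust the
  other points, so the pairs of \<xi> with points of \<open>C\<close> suffice.\<close>

lemma bounded_parabolic_imp_separates:
  assumes "bounded_parabolic G M \<phi> \<xi>"
  shows "\<exists>K. separates_from_all \<xi> K"
proof -
  have \<xi>: "\<xi> \<in> topspace M"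
    using assms unfolding bounded_parabolic_def parabolic_def by blast
  obtain C where C: "C \<subseteq> topspace M - {\<xi>}" "compactin M C"
    "translates (stabilizer G \<phi> \<xi>) \<phi> C = topspace M - {\<xi>}"
    using assms unfolding bounded_parabolic_def cocompact_on_def by blast
  let ?K = "(\<lambda>(x, y). {x, y}) ` ({\<xi>} \<times> C)"
  have "compactin (Theta2_topology M) ?K"
    using C \<xi> by (intro compactin_Theta2_Times) (auto simp: compactin_sing)
  moreover have "{\<xi>, \<eta>} \<in> translates (carrier G) (pair_action \<phi>) ?K"
    if \<eta>: "\<eta> \<in> topspace M - {\<xi>}" for \<eta>
  proof -
    have "\<eta> \<in> translates (stabilizer G \<phi> \<xi>) \<phi> C"
      using \<eta> C(3) by simp
    then obtain h c where h: "h \<in> stabilizer G \<phi> \<xi>" "c \<in> C" "\<eta> = \<phi> h c"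
      unfolding translates_def by blast
    then have "{\<xi>, \<eta>} = pair_action \<phi> h {\<xi>, c}" "h \<in> carrier G"
      by (auto simp: stabilizer_def)
    moreover have "{\<xi>, c} \<in> ?K"
      using h(2) by auto
    ultimately show ?thesis
      using translatesI[of h "carrier G" "{\<xi>, c}" ?K "pair_action \<phi>"] by simp
  qed
  ultimately show ?thesis
    unfolding separates_from_all_def by blast
qed

text \<open>A group element moves one point of the pair to \<xi>; the same \<open>K\<close> then
  works.\<close>

lemma separates_imp_orbit_pairs:
  assumes \<xi>: "\<xi> \<in> topspace M" and K: "separates_from_all \<xi> K"
  shows "Theta2 (orbit G \<phi> \<xi>) \<subseteq> translates (carrier G) (pair_action \<phi>) K"
proof
  interpret group G by (rule group_G)
  fix P assume "P \<in> Theta2 (orbit G \<phi> \<xi>)"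
  then obtain x y where xy: "x \<in> orbit G \<phi> \<xi>" "y \<in> orbit G \<phi> \<xi>" "x \<noteq> y" "P = {x, y}"
    unfolding nsets_2_eq by blast
  then obtain h where h: "h \<in> carrier G" "x = \<phi> h \<xi>"
    by (auto simp: orbit_def)
  have yX: "y \<in> topspace M"
    using xy(2) orbit_subset[OF \<xi>] by blast
  let ?\<eta> = "\<phi> (inv h) y"
  have \<eta>: "\<phi> h ?\<eta> = y" "?\<eta> \<in> topspace M"
    using h yX by simp_all
  then have "?\<eta> \<noteq> \<xi>"
    using xy(3) h by auto
  then have "{\<xi>, ?\<eta>} \<in> translates (carrier G) (pair_action \<phi>) K"
    using K \<eta>(2) unfolding separates_from_all_def by blast
  then obtain k Q where k: "k \<in> carrier G" "Q \<in> K" "{\<xi>, ?\<eta>} = \<phi> k ` Q"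
    unfolding translates_def by blast
  have "K \<subseteq> Theta2 (topspace M)"
    using K compactin_subset_topspace[of "Theta2_topology M" K]
    unfolding separates_from_all_def topspace_Theta2_topology by blast
  then have QX: "Q \<subseteq> topspace M"
    using k(2) by (auto simp: nsets_def)
  have "P = \<phi> h ` {\<xi>, ?\<eta>}"
    using xy(4) h(2) \<eta>(1) by simp
  also have "\<dots> = \<phi> h ` \<phi> k ` Q"
    by (simp only: k(3))
  also have "\<dots> = \<phi> (h \<otimes> k) ` Q"
    using QX h(1) k(1) by (auto simp: image_image composition_rule subset_iff intro!: image_cong)
  finally show "P \<in> translates (carrier G) (pair_action \<phi>) K"
    using h(1) k(1,2) unfolding translates_def by blast
qed

text \<open>\<open>K\<close> avoids an entourage \<open>U\<close>, so the inverse of an element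
  carrying a pair of \<open>K\<close> onto \<open>{p, q}\<close> moves \<open>p\<close> and
  \<open>q\<close> \<open>U\<close>-apart. This is the separation hypothesis used for a non-conical
  point.\<close>

lemma orbit_pairs_imp_conical_or_parabolic:
  assumes \<xi>: "\<xi> \<in> topspace M" and K: "compactin (Theta2_topology M) K"
    and orb: "Theta2 (orbit G \<phi> \<xi>) \<subseteq> translates (carrier G) (pair_action \<phi>) K"
  shows "conical G M \<phi> \<xi> \<or> bounded_parabolic G M \<phi> \<xi>"
proof (cases "conical G M \<phi> \<xi>")
  case nc: False
  interpret group G by (rule group_G)
  obtain U where U: "entourage M U" "\<And>x y. {x, y} \<in> K \<Longrightarrow> (x, y) \<notin> U"
    using compactin_Theta2_avoids_entourage[OF compact Hausdorff K] by blast
  have "bounded_parabolic G M \<phi> \<xi>"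
  proof (rule bounded_parabolic_if_separated[OF nc \<xi> U(1)])
    fix p q assume pq: "p \<in> orbit G \<phi> \<xi>" "q \<in> orbit G \<phi> \<xi>" "p \<noteq> q"
    have "{p, q} \<in> Theta2 (orbit G \<phi> \<xi>)"
      using pq by (simp add: nsets_def)
    then obtain g Q where g: "g \<in> carrier G" "Q \<in> K" "{p, q} = \<phi> g ` Q"
      using orb unfolding translates_def by blast
    have "Q \<subseteq> topspace M"
      using compactin_subset_topspace[OF K] g(2) unfolding topspace_Theta2_topology
      by (auto simp: nsets_def)
    then have "\<phi> (inv g) ` \<phi> g ` Q = Q"
      using g(1) by (auto simp: image_image subset_iff)
    then have "{\<phi> (inv g) p, \<phi> (inv g) q} = Q"
      unfolding g(3)[symmetric] by simp
    then have "(\<phi> (inv g) p, \<phi> (inv g) q) \<notin> U"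
      using U(2) g(2) by blast
    then show "\<exists>f\<in>carrier G. (\<phi> f p, \<phi> f q) \<notin> U"
      using g(1) by (intro bexI[of _ "inv g"]) auto
  qed
  then show ?thesis ..
qed simp

end

theorem theorem1p3:
  fixes G :: "('g, 'r) monoid_scheme" and M :: "'a topology"
    and \<phi> :: "'g \<Rightarrow> 'a \<Rightarrow> 'a" and \<xi> :: 'a
  assumes "convergence_action G M \<phi>"
    and "non_elementary G M \<phi>"
    and "topologically_minimal G M \<phi>"
    and "\<xi> \<in> topspace M"
  shows "(conical G M \<phi> \<xi> \<or> bounded_parabolic G M \<phi> \<xi> \<longleftrightarrow>
          (\<exists>K. compactin (Theta2_topology M) K \<and>
             (\<forall>\<eta>\<in>topspace M - {\<xi>}. {\<xi>, \<eta>} \<in> translates (carrier G) (pair_action \<phi>) K))) \<and>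
         ((\<exists>K. compactin (Theta2_topology M) K \<and>
             (\<forall>\<eta>\<in>topspace M - {\<xi>}. {\<xi>, \<eta>} \<in> translates (carrier G) (pair_action \<phi>) K)) \<longleftrightarrow>
          (\<exists>K. compactin (Theta2_topology M) K \<and>
             Theta2 (orbit G \<phi> \<xi>) \<subseteq> translates (carrier G) (pair_action \<phi>) K))"
proof -
  interpret minimal_convergence_action G M \<phi>
    using assms(1-3) by (simp add: minimal_convergence_action_def minimal_convergence_action_axioms_def)
  \<comment> \<open>The equivalences are proved as a cycle through the three conditions.\<close>
  have "conical G M \<phi> \<xi> \<or> bounded_parabolic G M \<phi> \<xi> \<Longrightarrow> \<exists>K. separates_from_all \<xi> K"
    using conical_imp_separates bounded_parabolic_imp_separates by blast
  moreover have "\<exists>K. separates_from_all \<xi> K \<Longrightarrow> \<exists>K. compactin (Theta2_topology M) K \<and>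
      Theta2 (orbit G \<phi> \<xi>) \<subseteq> translates (carrier G) (pair_action \<phi>) K"
    using separates_imp_orbit_pairs[OF assms(4)] unfolding separates_from_all_def by blast
  moreover have "\<exists>K. compactin (Theta2_topology M) K \<and>
      Theta2 (orbit G \<phi> \<xi>) \<subseteq> translates (carrier G) (pair_action \<phi>) K \<Longrightarrow>
      conical G M \<phi> \<xi> \<or> bounded_parabolic G M \<phi> \<xi>"
    using orbit_pairs_imp_conical_or_parabolic[OF assms(4)] by blast
  ultimately show ?thesis
    unfolding separates_from_all_def by argo
qed

end
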